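(* Let $\Bbbk$ be any field and let $f:\mathbb{N}\to\mathbb{Z}_{\ge 0}$ be a convergent function, i.e. there is $t_0$ with $f(t)=f(t_0)$ for all $t\ge t_0$. Then there exist a polynomial ring $S$ over $\Bbbk$ and a monomial ideal $Q\subseteq S$ such that $\operatorname{depth} S/Q^t=f(t)$ for all $t\ge 1$.
   Context: For a homogeneous ideal $Q$ in a polynomial ring $S$ over a field, $\operatorname{depth} S/Q^t$ denotes the depth of $S/Q^t$ with respect to the maximal homogeneous ideal of $S$. Here $\mathbb{N}=\{1,2,3,\dots\}$. *)

theory Defs
  imports Main "HOL-Library.Poly_Mapping" "HOL-Library.Extended_Nat"
begin

text \<open>Polynomials over a field 'k in the variables x_0, x_1, ...:
  a polynomial is a finitely supported map from exponent vectors
  (finitely supported maps nat => nat) to coefficients.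
  The polynomial ring k[x_0,...,x_{n-1}] is the subset of those polynomials
  that only involve the first n variables.\<close>

type_synonym 'k mpoly = "(nat \<Rightarrow>\<^sub>0 nat) \<Rightarrow>\<^sub>0 'k"

definition polyring :: "nat \<Rightarrow> ('k::field) mpoly set" where
  "polyring n = {p. \<forall>m\<in>Poly_Mapping.keys p. Poly_Mapping.keys m \<subseteq> {..<n}}"

definition ideal_gen :: "nat \<Rightarrow> ('k::field) mpoly set \<Rightarrow> 'k mpoly set" where
  "ideal_gen n G = {p. \<exists>(k::nat) c g. (\<forall>i<k. c i \<in> polyring n \<and> g i \<in> G)
                         \<and> p = (\<Sum>i<k. c i * g i)}"

definition monom1 :: "(nat \<Rightarrow>\<^sub>0 nat) \<Rightarrow> ('k::field) mpoly" where
  "monom1 m = Poly_Mapping.single m 1"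

definition monomial_ideal :: "nat \<Rightarrow> ('k::field) mpoly set \<Rightarrow> bool" where
  "monomial_ideal n Q \<longleftrightarrow>
     (\<exists>M. (\<forall>m\<in>M. Poly_Mapping.keys m \<subseteq> {..<n}) \<and> Q = ideal_gen n (monom1 ` M))"

definition ideal_pow :: "nat \<Rightarrow> ('k::field) mpoly set \<Rightarrow> nat \<Rightarrow> 'k mpoly set" where
  "ideal_pow n Q t = ideal_gen n {prod_list xs | xs. length xs = t \<and> set xs \<subseteq> Q}"

definition max_hom_ideal :: "nat \<Rightarrow> ('k::field) mpoly set" where
  "max_hom_ideal n = {p \<in> polyring n. Poly_Mapping.lookup p 0 = 0}"

definition regular_seq :: "nat \<Rightarrow> ('k::field) mpoly set \<Rightarrow> 'k mpoly list \<Rightarrow> bool" where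
  "regular_seq n I xs \<longleftrightarrow>
     set xs \<subseteq> max_hom_ideal n \<and>
     (\<forall>i<length xs. \<forall>p\<in>polyring n.
        xs ! i * p \<in> ideal_gen n (I \<union> set (take i xs)) \<longrightarrow>
        p \<in> ideal_gen n (I \<union> set (take i xs))) \<and>
     ideal_gen n (I \<union> set xs) \<noteq> polyring n"

text \<open>depth of S/I w.r.t. the maximal homogeneous ideal (S = k[x_0..x_{n-1}]);
  the zero module (I = S) has depth \<infinity> by the usual convention.\<close>
definition depth_quot :: "nat \<Rightarrow> ('k::field) mpoly set \<Rightarrow> enat" where
  "depth_quot n I = (if I = polyring n then \<infinity>
                     else Sup {enat (length xs) | xs. regular_seq n I xs})"

end

theory Submission
  imports Defs
begin

text \<open>
  If \<open>I\<close> and \<open>J\<close> are monomial ideals in polynomial rings \<open>A\<close> and \<open>B\<close> that share exactly one variable, then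
  the depth of the quotient by \<open>(I J)^t\<close> is the sum of the depths of \<open>A/I^t\<close> and \<open>B/J^t\<close>. Hence it is enough to
  realise, for every \<open>d \<ge> 1\<close>, the depth functions \<open>[t = d]\<close> and \<open>[t \<ge> d]\<close>: a convergent \<open>f\<close> is a finite sum
  of these.

  Both come from the ideal \<open>I\<close> generated by the monomials \<open>x^(d+2-e) y^e z^c\<close> with \<open>e \<le> d + 2\<close>, where \<open>c = e - 1\<close> for
  \<open>1 \<le> e \<le> d\<close> and \<open>c = 0\<close> for the other \<open>e\<close>. The maximal ideal is associated to \<open>I^t\<close> for \<open>t < d\<close>,
  whereas \<open>I^t = (x, y)^((d+2)t)\<close> for \<open>t \<ge> d\<close>. The ideal \<open>J = (w^(d+1), w x^(d-1) z, x^d z)\<close> behaves the other way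
  round: the quotient by \<open>J^t\<close> has depth 1 for \<open>t \<le> d\<close> and depth 0 for \<open>t > d\<close>. Since they share the two
  variables \<open>x\<close> and \<open>z\<close>, the product \<open>I J\<close> has depth function \<open>[t = d]\<close>; replacing \<open>J\<close> by \<open>(x, w)\<close> gives
  \<open>[t \<ge> d]\<close>.

  In all cases the maximal regular sequences consist of differences \<open>z - y\<close>, one for each factor of depth 1; dividing
  them out only identifies variables, so that regularity and the existence of a socle element remain questions about
  monomials. That no regular sequence is longer follows from Koszul cohomology.
\<close>

section \<open>Koszul cohomology\<close>

text \<open>\<open>R\<close> is a subset of the ambient ring, not the whole type, because the
  polynomial ring in \<open>n\<close> variables is a subset of the type of all polynomials.\<close>

locale koszul =
  fixes R :: "'a::comm_ring_1 set" and n :: nat and x :: "nat \<Rightarrow> 'a"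
  assumes zero_in: "0 \<in> R" and one_in: "1 \<in> R"
    and add_in: "a \<in> R \<Longrightarrow> b \<in> R \<Longrightarrow> a + b \<in> R"
    and mult_in: "a \<in> R \<Longrightarrow> b \<in> R \<Longrightarrow> a * b \<in> R"
    and uminus_in: "a \<in> R \<Longrightarrow> - a \<in> R"
    and x_in: "i < n \<Longrightarrow> x i \<in> R"
begin

definition ideal_in :: "'a set \<Rightarrow> bool" where
  "ideal_in J \<longleftrightarrow> J \<subseteq> R \<and> 0 \<in> J \<and> (\<forall>a\<in>J. \<forall>b\<in>J. a + b \<in> J) \<and> (\<forall>r\<in>R. \<forall>a\<in>J. r * a \<in> J)"

text \<open>The ideal \<open>J + y R\<close>, written so that a coefficient of \<open>y\<close> can
  be extracted.\<close>

definition adj :: "'a set \<Rightarrow> 'a \<Rightarrow> 'a set" where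
  "adj J y = {q \<in> R. \<exists>e\<in>R. q - y * e \<in> J}"

text \<open>A Koszul cochain of degree \<open>p\<close> is a function on the \<open>p\<close>-element subsets of \<open>{..<n}\<close>. The recursion on the
  number of variables presents the Koszul complex as an iterated mapping cone, so that no signs have to be tracked.\<close>

primrec D :: "nat \<Rightarrow> (nat set \<Rightarrow> 'a) \<Rightarrow> nat set \<Rightarrow> 'a" where
  "D 0 c F = 0"
| "D (Suc k) c F = (if k \<in> F then x k * c (F - {k}) - D k (\<lambda>G. c (insert k G)) (F - {k}) else D k c F)"

text \<open>Contraction in direction \<open>i\<close>: for \<open>i < k\<close>, up to a sign, the
  value at \<open>F\<close> is \<open>c (insert i F)\<close> if \<open>i\<close> is not in
  \<open>F\<close>, and 0 otherwise.\<close>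

primrec H :: "nat \<Rightarrow> nat \<Rightarrow> (nat set \<Rightarrow> 'a) \<Rightarrow> nat set \<Rightarrow> 'a" where
  "H 0 i c F = 0"
| "H (Suc k) i c F =
    (if i = k then (if k \<in> F then 0 else c (insert k F))
     else if k \<in> F then - H k i (\<lambda>G. c (insert k G)) (F - {k}) else H k i c F)"

text \<open>The \<open>p\<close>-th Koszul cohomology of \<open>R/J\<close> is zero.\<close>

definition vanish :: "nat \<Rightarrow> 'a set \<Rightarrow> bool" where
  "vanish p J \<longleftrightarrow> (\<forall>c. (\<forall>F. c F \<in> R) \<longrightarrow>
     (\<forall>F\<subseteq>{..<n}. card F = Suc p \<longrightarrow> D n c F \<in> J) \<longrightarrow>
     (\<exists>b. (\<forall>F. b F \<in> R) \<and> (\<forall>F\<subseteq>{..<n}. card F = p \<longrightarrow> c F - D n b F \<in> J)))"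

lemma ideal_inD:
  assumes "ideal_in J"
  shows "J \<subseteq> R" "0 \<in> J" "a \<in> J \<Longrightarrow> b \<in> J \<Longrightarrow> a + b \<in> J" "r \<in> R \<Longrightarrow> a \<in> J \<Longrightarrow> r * a \<in> J"
  using assms by (auto simp: ideal_in_def)

lemma ideal_in_uminus: "ideal_in J \<Longrightarrow> a \<in> J \<Longrightarrow> - a \<in> J"
  using ideal_inD(4)[of J "- 1" a] uminus_in[OF one_in] by simp

lemma ideal_in_diff: "ideal_in J \<Longrightarrow> a \<in> J \<Longrightarrow> b \<in> J \<Longrightarrow> a - b \<in> J"
  using ideal_inD(3)[of J a "- b"] ideal_in_uminus[of J b] by simp

lemma ideal_in_sum: "ideal_in J \<Longrightarrow> (\<And>i. i \<in> A \<Longrightarrow> g i \<in> J) \<Longrightarrow> sum g A \<in> J"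
  by (induction A rule: infinite_finite_induct) (auto intro: ideal_inD)

lemma ideal_in_R: "ideal_in R"
  by (auto simp: ideal_in_def zero_in add_in mult_in)

lemma ideal_in_adj:
  assumes J: "ideal_in J" and y: "y \<in> R"
  shows "ideal_in (adj J y)" "J \<subseteq> adj J y" "e \<in> R \<Longrightarrow> y * e \<in> adj J y"
proof -
  have "a + b \<in> adj J y" if "a \<in> adj J y" "b \<in> adj J y" for a b
  proof -
    from that obtain e e' where "e \<in> R" "e' \<in> R" "a - y * e \<in> J" "b - y * e' \<in> J" "a \<in> R" "b \<in> R"
      by (auto simp: adj_def)
    moreover from this have "(a - y * e) + (b - y * e') \<in> J" using ideal_inD(3)[OF J] by blast
    hence "a + b - y * (e + e') \<in> J" by (simp add: algebra_simps)
    ultimately show ?thesis by (auto simp: adj_def intro!: add_in bexI[of _ "e + e'"])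
  qed
  moreover have "r * a \<in> adj J y" if "a \<in> adj J y" "r \<in> R" for a r
  proof -
    from that obtain e where "e \<in> R" "a - y * e \<in> J" "a \<in> R"
      by (auto simp: adj_def)
    moreover from this have "r * (a - y * e) \<in> J" using ideal_inD(4)[OF J that(2)] by blast
    hence "r * a - y * (r * e) \<in> J" by (simp add: algebra_simps)
    ultimately show ?thesis using that by (auto simp: adj_def intro!: mult_in bexI[of _ "r * e"])
  qed
  moreover have "J \<subseteq> adj J y"
    using ideal_inD(1)[OF J] by (auto simp: adj_def intro!: bexI[of _ 0] zero_in)
  ultimately show "ideal_in (adj J y)" "J \<subseteq> adj J y"
    using ideal_inD(2)[OF J] by (auto simp: ideal_in_def) (auto simp: adj_def)
  show "e \<in> R \<Longrightarrow> y * e \<in> adj J y"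
    using ideal_inD(2)[OF J] y by (auto simp: adj_def intro!: mult_in bexI[of _ e])
qed

section \<open>Formal properties of the differential and the contraction\<close>

lemma D_Suc_in: "k \<in> F \<Longrightarrow> D (Suc k) c F = x k * c (F - {k}) - D k (\<lambda>G. c (insert k G)) (F - {k})"
  and D_Suc_notin: "k \<notin> F \<Longrightarrow> D (Suc k) c F = D k c F"
  and H_Suc_in: "k \<in> F \<Longrightarrow> H (Suc k) i c F = (if i = k then 0 else - H k i (\<lambda>G. c (insert k G)) (F - {k}))"
  and H_Suc_notin: "k \<notin> F \<Longrightarrow> H (Suc k) i c F = (if i = k then c (insert k F) else H k i c F)"
  by auto

lemma D_cong: "(\<And>G. G \<subseteq> F \<Longrightarrow> c G = c' G) \<Longrightarrow> D k c F = D k c' F"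
proof (induction k arbitrary: c c' F)
  case (Suc k)
  show ?case
  proof (cases "k \<in> F")
    case True
    have "D k (\<lambda>G. c (insert k G)) (F - {k}) = D k (\<lambda>G. c' (insert k G)) (F - {k})"
      by (rule Suc.IH, rule Suc.prems) (use True in auto)
    moreover have "c (F - {k}) = c' (F - {k})" by (rule Suc.prems) auto
    ultimately show ?thesis using True by simp
  next
    case False
    then show ?thesis using Suc.IH[OF Suc.prems] by simp
  qed
qed simp

lemma H_cong: "(\<And>j. j < k \<Longrightarrow> c (insert j F) = c' (insert j F)) \<Longrightarrow> H k i c F = H k i c' F"
proof (induction k arbitrary: c c' F)
  case (Suc k)
  have "H k i (\<lambda>G. c (insert k G)) (F - {k}) = H k i (\<lambda>G. c' (insert k G)) (F - {k})" if "k \<in> F"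
  proof (rule Suc.IH)
    fix j assume "j < k"
    moreover have "insert k (insert j (F - {k})) = insert j F" using that by auto
    ultimately show "c (insert k (insert j (F - {k}))) = c' (insert k (insert j (F - {k})))"
      using Suc.prems[of j] by simp
  qed
  moreover have "H k i c F = H k i c' F" by (rule Suc.IH) (use Suc.prems in auto)
  ultimately show ?case using Suc.prems[of k] by auto
qed simp

lemma D_diff: "D k (\<lambda>G. c G - c' G) F = D k c F - D k c' F"
  by (induction k arbitrary: c c' F) (auto simp: algebra_simps)

lemma D_uminus: "D k (\<lambda>G. - c G) F = - D k c F"
  by (induction k arbitrary: c F) (auto simp: algebra_simps)

lemma D_scale: "D k (\<lambda>G. a * c G) F = a * D k c F"
  by (induction k arbitrary: c F) (auto simp: algebra_simps)

lemma D_zero: "D k (\<lambda>G. 0) F = 0"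
  using D_scale[of k 0 "\<lambda>G. 0"] by simp

lemma D_add: "D k (\<lambda>G. c G + c' G) F = D k c F + D k c' F"
  by (induction k arbitrary: c c' F) (auto simp: algebra_simps)

lemma D_sum: "D k (\<lambda>G. \<Sum>i\<in>A. c i G) F = (\<Sum>i\<in>A. D k (c i) F)"
  by (induction A rule: infinite_finite_induct) (auto simp: D_zero D_add)

lemma D_empty: "D k c {} = 0"
  by (induction k) auto

lemma H_diff: "H k i (\<lambda>G. c G - c' G) F = H k i c F - H k i c' F"
  by (induction k arbitrary: c c' F) (auto simp: algebra_simps)

lemma H_scale: "H k i (\<lambda>G. a * c G) F = a * H k i c F"
  by (induction k arbitrary: c F) (auto simp: algebra_simps)

lemma D_singleton: "i < k \<Longrightarrow> D k c {i} = x i * c {}"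
  by (induction k) (auto simp: D_empty less_Suc_eq)

text \<open>On sets containing \<open>k\<close> the two mixed terms \<open>x k * D k c\<close>
  cancel by linearity, and what remains is the claim for \<open>k\<close> variables.\<close>

lemma D_D: "D k (D k c) F = 0"
proof (induction k arbitrary: c F)
  case (Suc k)
  show ?case
  proof (cases "k \<in> F")
    case True
    define F' where "F' = F - {k}"
    have "D k (\<lambda>G. D (Suc k) c (insert k G)) F'
        = D k (\<lambda>G. x k * c G - D k (\<lambda>G. c (insert k G)) G) F'"
      by (rule D_cong) (auto simp: F'_def subset_Diff_insert)
    also have "\<dots> = x k * D k c F'"
      by (simp add: D_diff D_scale Suc.IH)
    finally have "D k (\<lambda>G. D (Suc k) c (insert k G)) F' = x k * D k c F'" .
    moreover have "D (Suc k) c F' = D k c F'" by (simp add: F'_def)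
    moreover have "D (Suc k) (D (Suc k) c) F = x k * D (Suc k) c F' - D k (\<lambda>G. D (Suc k) c (insert k G)) F'"
      using D_Suc_in[OF True] unfolding F'_def .
    ultimately show ?thesis by (simp del: D.simps)
  next
    case False
    have "D k (D (Suc k) c) F = D k (D k c) F"
      by (rule D_cong) (use False in auto)
    then show ?thesis using False Suc.IH by (simp add: D_Suc_notin del: D.simps)
  qed
qed simp

text \<open>Contraction against the \<open>i\<close>-th variable is a null homotopy of multiplication by it.\<close>

lemma homotopy: "i < k \<Longrightarrow> D k (H k i c) F + H k i (D k c) F = x i * c F"
proof (induction k arbitrary: c F)
  case (Suc k)
  consider "i = k" "k \<in> F" | "i = k" "k \<notin> F" | "i < k" "k \<in> F" | "i < k" "k \<notin> F"
    using Suc.prems by linarith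
  then show ?case
  proof cases
    case 1
    have "D k (\<lambda>G. H (Suc k) i c (insert k G)) (F - {k}) = D k (\<lambda>G. 0) (F - {k})"
      using 1 by (intro D_cong) auto
    then show ?thesis using 1 by (simp add: D_zero insert_absorb D_Suc_in H_Suc_in del: D.simps H.simps)
     (simp add: H_Suc_notin insert_absorb del: H.simps)
  next
    case 2
    have "D k (H (Suc k) i c) F = D k (\<lambda>G. c (insert k G)) F"
      using 2 by (intro D_cong) auto
    then show ?thesis using 2 by (simp add: D_Suc_in D_Suc_notin H_Suc_notin del: D.simps H.simps)
  next
    case 3
    define F' where "F' = F - {k}"
    define c' where "c' = (\<lambda>G. c (insert k G))"
    have k: "k \<notin> F'" by (simp add: F'_def)
    have "D k (\<lambda>G. H (Suc k) i c (insert k G)) F' = D k (\<lambda>G. - H k i c' G) F'"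
    proof (rule D_cong)
      fix G assume "G \<subseteq> F'"
      hence "insert k G - {k} = G" using k by auto
      then show "H (Suc k) i c (insert k G) = - H k i c' G" using 3 by (simp add: c'_def)
    qed
    hence 1: "D (Suc k) (H (Suc k) i c) F = x k * H k i c F' + D k (H k i c') F'"
      using 3 k by (simp add: F'_def D_uminus D_Suc_in H_Suc_notin del: D.simps H.simps)
    have "H k i (\<lambda>G. D (Suc k) c (insert k G)) F' = H k i (\<lambda>G. x k * c G - D k c' G) F'"
    proof (rule H_cong)
      fix j assume "j < k"
      hence "insert k (insert j F') - {k} = insert j F'" using k by auto
      then show "D (Suc k) c (insert k (insert j F')) = x k * c (insert j F') - D k c' (insert j F')"
        by (simp add: c'_def)
    qed
    hence 2: "H (Suc k) i (D (Suc k) c) F = - x k * H k i c F' + H k i (D k c') F'"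
      using 3 by (simp add: F'_def H_diff H_scale H_Suc_in del: D.simps H.simps)
    have "c' F' = c F" using 3 by (simp add: F'_def c'_def insert_absorb)
    then show ?thesis unfolding 1 2 using Suc.IH[OF 3(1), of c' F'] by simp
  next
    case 4
    have "D k (H (Suc k) i c) F = D k (H k i c) F"
    proof (rule D_cong)
      fix G assume "G \<subseteq> F"
      hence "k \<notin> G" using 4 by auto
      then show "H (Suc k) i c G = H k i c G" using 4 by simp
    qed
    moreover have "H k i (D (Suc k) c) F = H k i (D k c) F"
      using 4 by (intro H_cong) (auto simp: D_Suc_notin simp del: D.simps)
    ultimately show ?thesis using 4 Suc.IH[OF 4(1)]
      by (simp add: D_Suc_notin H_Suc_notin del: D.simps H.simps)
  qed
qed simp

text \<open>\<open>D\<close> raises the degree by one, so it maps cochains with values in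
  \<open>J\<close> in one degree to such cochains in the next. With \<open>H_mem\<close>, which
  lowers the degree, this permits calculations modulo \<open>J\<close> with representatives.\<close>

lemma D_mem:
  assumes J: "ideal_in J"
  shows "k \<le> n \<Longrightarrow> finite F \<Longrightarrow> (\<And>G. G \<subseteq> F \<Longrightarrow> Suc (card G) = card F \<Longrightarrow> c G \<in> J) \<Longrightarrow> D k c F \<in> J"
proof (induction k arbitrary: c F)
  case 0
  then show ?case using ideal_inD[OF J] by simp
next
  case (Suc k)
  show ?case
  proof (cases "k \<in> F")
    case True
    have "D k (\<lambda>G. c (insert k G)) (F - {k}) \<in> J"
    proof (rule Suc.IH)
      fix G assume G: "G \<subseteq> F - {k}" "Suc (card G) = card (F - {k})"
      have "finite G" "k \<notin> G" using G Suc.prems(2) finite_subset by auto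
      then show "c (insert k G) \<in> J"
        using G True Suc.prems(2) by (intro Suc.prems(3)) (auto simp: card_Suc_Diff1)
    qed (use Suc.prems in auto)
    moreover have "c (F - {k}) \<in> J"
      using True Suc.prems(2) by (intro Suc.prems(3)) (auto simp: card_Suc_Diff1 simp del: card_Diff_insert)
    ultimately show ?thesis
      using True x_in[of k] Suc.prems(1) by (auto intro!: ideal_in_diff[OF J] ideal_inD(4)[OF J])
  next
    case False
    then show ?thesis using Suc.IH[of F c] Suc.prems by simp
  qed
qed

lemma H_mem:
  assumes J: "ideal_in J"
  shows "finite F \<Longrightarrow> (\<And>j. j < k \<Longrightarrow> j \<notin> F \<Longrightarrow> c (insert j F) \<in> J) \<Longrightarrow> H k i c F \<in> J"
proof (induction k arbitrary: c F)
  case 0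
  then show ?case using ideal_inD[OF J] by simp
next
  case (Suc k)
  have "H k i (\<lambda>G. c (insert k G)) (F - {k}) \<in> J" if "k \<in> F"
  proof (rule Suc.IH)
    fix j assume "j < k" "j \<notin> F - {k}"
    moreover have "insert k (insert j (F - {k})) = insert j F" using that by auto
    ultimately show "c (insert k (insert j (F - {k}))) \<in> J" using Suc.prems by auto
  qed (use Suc.prems in auto)
  moreover have "H k i c F \<in> J" by (rule Suc.IH) (use Suc.prems in auto)
  ultimately show ?case
    using Suc.prems(2)[of k] ideal_inD(2)[OF J] ideal_in_uminus[OF J] by auto
qed

lemma D_mem_card:
  assumes "ideal_in J" "\<And>F. F \<subseteq> {..<n} \<Longrightarrow> card F = p \<Longrightarrow> c F \<in> J" "F \<subseteq> {..<n}" "card F = Suc p"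
  shows "D n c F \<in> J"
  using assms by (intro D_mem[OF assms(1)]) (auto intro: finite_subset)

lemma D_in_R: "(\<And>F. c F \<in> R) \<Longrightarrow> F \<subseteq> {..<n} \<Longrightarrow> D n c F \<in> R"
  by (intro D_mem[OF ideal_in_R]) (auto intro: finite_subset)

section \<open>Vanishing of cohomology and regular elements\<close>

lemma choose_coefficients:
  assumes "\<And>F. F \<subseteq> {..<n} \<Longrightarrow> card F = p \<Longrightarrow> g F \<in> adj J y"
  shows "\<exists>e. (\<forall>F. e F \<in> R) \<and> (\<forall>F\<subseteq>{..<n}. card F = p \<longrightarrow> g F - y * e F \<in> J)"
proof -
  have "\<exists>e. e \<in> R \<and> (F \<subseteq> {..<n} \<longrightarrow> card F = p \<longrightarrow> g F - y * e \<in> J)" for F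
  proof (cases "F \<subseteq> {..<n} \<and> card F = p")
    case True
    then show ?thesis using assms[of F] unfolding adj_def by blast
  qed (use zero_in in blast)
  hence "\<forall>F. \<exists>e. e \<in> R \<and> (F \<subseteq> {..<n} \<longrightarrow> card F = p \<longrightarrow> g F - y * e \<in> J)" ..
  hence "\<exists>e. \<forall>F. e F \<in> R \<and> (F \<subseteq> {..<n} \<longrightarrow> card F = p \<longrightarrow> g F - y * e F \<in> J)"
    by (rule choice)
  then show ?thesis by blast
qed

lemma vanishD:
  assumes "vanish p J" "\<And>F. c F \<in> R" "\<And>F. F \<subseteq> {..<n} \<Longrightarrow> card F = Suc p \<Longrightarrow> D n c F \<in> J"
  shows "\<exists>b. (\<forall>F. b F \<in> R) \<and> (\<forall>F\<subseteq>{..<n}. card F = p \<longrightarrow> c F - D n b F \<in> J)"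
  using assms by (auto simp: vanish_def)

text \<open>A cocycle of degree 0 is an element killed by all \<open>x i\<close> modulo
  \<open>J\<close>, hence by their combination \<open>y\<close>; regularity of \<open>y\<close>
  makes it zero.\<close>

lemma vanish_0:
  assumes J: "ideal_in J" and r: "\<And>i. i < n \<Longrightarrow> r i \<in> R" and y: "y = (\<Sum>i<n. r i * x i)"
    and reg: "\<And>p. p \<in> R \<Longrightarrow> y * p \<in> J \<Longrightarrow> p \<in> J"
  shows "vanish 0 J"
  unfolding vanish_def
proof (intro allI impI)
  fix c assume c: "\<forall>F. c F \<in> R" and cyc: "\<forall>F\<subseteq>{..<n}. card F = Suc 0 \<longrightarrow> D n c F \<in> J"
  have "r i * (x i * c {}) \<in> J" if "i < n" for i
    using cyc[rule_format, of "{i}"] that r by (intro ideal_inD(4)[OF J, of "r i"]) (auto simp: D_singleton)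
  hence "y * c {} \<in> J"
    unfolding y sum_distrib_right by (intro ideal_in_sum[OF J]) (auto simp: mult.assoc)
  hence "c {} \<in> J" using reg c by blast
  then show "\<exists>b. (\<forall>F. b F \<in> R) \<and> (\<forall>F\<subseteq>{..<n}. card F = 0 \<longrightarrow> c F - D n b F \<in> J)"
    by (intro exI[of _ "\<lambda>F. 0"]) (auto simp: zero_in D_zero card_eq_0_iff finite_subset)
qed

text \<open>This lemma and the next one are the two halves of the long exact sequence of multiplication by \<open>y\<close>; multiplication
  by \<open>y\<close> is zero on cohomology because \<open>y\<close> is a combination of the \<open>x i\<close>.\<close>

lemma vanish_Suc:
  assumes J: "ideal_in J" and r: "\<And>i. i < n \<Longrightarrow> r i \<in> R" and y: "y = (\<Sum>i<n. r i * x i)"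
    and reg: "\<And>p. p \<in> R \<Longrightarrow> y * p \<in> J \<Longrightarrow> p \<in> J" and van: "vanish p (adj J y)"
  shows "vanish (Suc p) J"
  unfolding vanish_def
proof (intro allI impI)
  fix c assume c: "\<forall>F. c F \<in> R" and cyc: "\<forall>F\<subseteq>{..<n}. card F = Suc (Suc p) \<longrightarrow> D n c F \<in> J"
  have yR: "y \<in> R" unfolding y by (intro ideal_in_sum[OF ideal_in_R]) (auto intro: mult_in r x_in)
  \<comment> \<open>The homotopies of the \<open>x i\<close>, combined with the coefficients of
    \<open>y\<close>, give a primitive of \<open>y c\<close> modulo \<open>J\<close>. The value 0 on
    infinite sets keeps \<open>b\<close> inside \<open>R\<close> everywhere.\<close>
  define b where "b = (\<lambda>F. if finite F then \<Sum>i<n. r i * H n i c F else 0)"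
  have bR: "b F \<in> R" for F
    unfolding b_def by (auto intro!: ideal_in_sum[OF ideal_in_R] mult_in r H_mem[OF ideal_in_R] zero_in c[rule_format])
  have yc: "y * c F - D n b F \<in> J" if F: "F \<subseteq> {..<n}" "card F = Suc p" for F
  proof -
    have fin: "finite F" using F finite_subset by auto
    have "D n b F = D n (\<lambda>G. \<Sum>i<n. r i * H n i c G) F"
      by (rule D_cong) (auto simp: b_def finite_subset[OF _ fin])
    also have "\<dots> = (\<Sum>i<n. r i * D n (H n i c) F)"
      by (simp add: D_sum D_scale)
    finally have "y * c F - D n b F = (\<Sum>i<n. r i * (x i * c F - D n (H n i c) F))"
      by (simp only: y sum_distrib_right sum_subtractf right_diff_distrib mult.assoc)
    also have "\<dots> = (\<Sum>i<n. r i * H n i (D n c) F)"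
    proof (rule sum.cong)
      fix i assume "i \<in> {..<n}"
      hence "x i * c F - D n (H n i c) F = H n i (D n c) F"
        using homotopy[of i n c F] by (simp add: algebra_simps)
      then show "r i * (x i * c F - D n (H n i c) F) = r i * H n i (D n c) F" by simp
    qed simp
    also have "\<dots> \<in> J"
    proof (intro ideal_in_sum[OF J] ideal_inD(4)[OF J] H_mem[OF J] fin)
      fix j assume "j < n" "j \<notin> F"
      then show "D n c (insert j F) \<in> J" using F fin by (intro cyc[rule_format]) auto
    qed (use r in auto)
    finally show ?thesis .
  qed
  \<comment> \<open>Since \<open>D b\<close> is congruent to \<open>y c\<close>, \<open>b\<close> is
    a cocycle modulo \<open>J + y R\<close>. Writing it as \<open>D a + y e\<close> modulo
    \<open>J\<close> and applying \<open>D\<close> turns \<open>e\<close> into a primitive of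
    \<open>c\<close>, once \<open>y\<close> is cancelled.\<close>
  have Db: "D n b F \<in> adj J y" if "F \<subseteq> {..<n}" "card F = Suc p" for F
  proof -
    have "D n b F - y * c F \<in> J" using ideal_in_uminus[OF J yc[OF that]] by simp
    then show ?thesis using D_in_R[of b F] bR that c by (auto simp: adj_def)
  qed
  obtain a where a0: "(\<forall>F. a F \<in> R) \<and> (\<forall>F\<subseteq>{..<n}. card F = p \<longrightarrow> b F - D n a F \<in> adj J y)"
    using vanishD[of p "adj J y" b, OF van bR Db] ..
  have aR: "a F \<in> R" for F using a0 by blast
  have a: "b F - D n a F \<in> adj J y" if "F \<subseteq> {..<n}" "card F = p" for F using a0 that by blast
  obtain e where e0: "(\<forall>F. e F \<in> R) \<and> (\<forall>F\<subseteq>{..<n}. card F = p \<longrightarrow> b F - D n a F - y * e F \<in> J)"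
    using choose_coefficients[of p "\<lambda>F. b F - D n a F" J y, OF a] ..
  have eR: "e F \<in> R" for F using e0 by blast
  have e: "b F - D n a F - y * e F \<in> J" if "F \<subseteq> {..<n}" "card F = p" for F using e0 that by blast
  have "c F - D n e F \<in> J" if F: "F \<subseteq> {..<n}" "card F = Suc p" for F
  proof -
    have "D n (\<lambda>G. b G - D n a G - y * e G) F \<in> J"
      using e F by (intro D_mem_card[OF J, of p]) auto
    hence "D n b F - y * D n e F \<in> J" by (simp add: D_diff D_scale D_D)
    hence "(y * c F - D n b F) + (D n b F - y * D n e F) \<in> J"
      by (intro ideal_inD(3)[OF J] yc F)
    hence "y * (c F - D n e F) \<in> J" by (simp add: algebra_simps)
    moreover have "c F - D n e F \<in> R"
      using c D_in_R[OF eR F(1)] by (intro ideal_in_diff[OF ideal_in_R]) auto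
    ultimately show ?thesis using reg by blast
  qed
  then show "\<exists>b. (\<forall>F. b F \<in> R) \<and> (\<forall>F\<subseteq>{..<n}. card F = Suc p \<longrightarrow> c F - D n b F \<in> J)"
    using eR by blast
qed

lemma vanish_adj:
  assumes J: "ideal_in J" and yR: "y \<in> R"
    and reg: "\<And>p. p \<in> R \<Longrightarrow> y * p \<in> J \<Longrightarrow> p \<in> J" and van: "vanish p J" "vanish (Suc p) J"
  shows "vanish p (adj J y)"
  unfolding vanish_def
proof (intro allI impI)
  fix c assume c: "\<forall>F. c F \<in> R" and cyc: "\<forall>F\<subseteq>{..<n}. card F = Suc p \<longrightarrow> D n c F \<in> adj J y"
  obtain e where e0: "(\<forall>F. e F \<in> R) \<and> (\<forall>F\<subseteq>{..<n}. card F = Suc p \<longrightarrow> D n c F - y * e F \<in> J)"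
    using choose_coefficients[of "Suc p" "D n c" J y, OF cyc[rule_format]] ..
  have eR: "e F \<in> R" for F using e0 by blast
  have e: "D n c F - y * e F \<in> J" if "F \<subseteq> {..<n}" "card F = Suc p" for F using e0 that by blast
  \<comment> \<open>The Bockstein argument: \<open>D c\<close> is congruent to \<open>y e\<close>,
    so \<open>y D e\<close> is zero modulo \<open>J\<close>, and \<open>y\<close> can be
    cancelled.\<close>
  have De: "D n e F \<in> J" if F: "F \<subseteq> {..<n}" "card F = Suc (Suc p)" for F
  proof -
    have "D n (\<lambda>G. D n c G - y * e G) F \<in> J"
      using e F by (intro D_mem_card[OF J, of "Suc p"]) auto
    hence "- (y * D n e F) \<in> J" by (simp add: D_diff D_scale D_D)
    hence "y * D n e F \<in> J" using ideal_in_uminus[OF J, of "- (y * D n e F)"] by simp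
    then show ?thesis by (rule reg[OF D_in_R[OF eR F(1)]])
  qed
  obtain a where a0: "(\<forall>F. a F \<in> R) \<and> (\<forall>F\<subseteq>{..<n}. card F = Suc p \<longrightarrow> e F - D n a F \<in> J)"
    using vanishD[of "Suc p" J e, OF van(2) eR De] ..
  have aR: "a F \<in> R" for F using a0 by blast
  have a: "e F - D n a F \<in> J" if "F \<subseteq> {..<n}" "card F = Suc p" for F using a0 that by blast
  \<comment> \<open>With \<open>e\<close> congruent to \<open>D a\<close>, subtracting
    \<open>y a\<close> corrects \<open>c\<close> to a cocycle modulo \<open>J\<close> without
    changing it modulo \<open>J + y R\<close>.\<close>
  have Dca: "D n (\<lambda>G. c G - y * a G) F \<in> J" if F: "F \<subseteq> {..<n}" "card F = Suc p" for F
  proof -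
    have "(D n c F - y * e F) + y * (e F - D n a F) \<in> J"
      by (rule ideal_inD(3)[OF J e[OF F] ideal_inD(4)[OF J yR a[OF F]]])
    then show ?thesis by (simp add: D_diff D_scale algebra_simps)
  qed
  have caR: "c F - y * a F \<in> R" for F
    by (rule ideal_in_diff[OF ideal_in_R c[rule_format] mult_in[OF yR aR]])
  obtain b where b0: "(\<forall>F. b F \<in> R) \<and> (\<forall>F\<subseteq>{..<n}. card F = p \<longrightarrow> c F - y * a F - D n b F \<in> J)"
    using vanishD[of p J "\<lambda>F. c F - y * a F", OF van(1) caR Dca] ..
  have bR: "b F \<in> R" for F using b0 by blast
  have b: "c F - y * a F - D n b F \<in> J" if "F \<subseteq> {..<n}" "card F = p" for F using b0 that by blast
  have "c F - D n b F \<in> adj J y" if F: "F \<subseteq> {..<n}" "card F = p" for F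
  proof -
    have "c F - D n b F - y * a F \<in> J" using b[OF F] by (simp add: algebra_simps)
    moreover have "c F - D n b F \<in> R"
      using c D_in_R[OF bR F(1)] by (intro ideal_in_diff[OF ideal_in_R]) auto
    ultimately show ?thesis using aR by (auto simp: adj_def)
  qed
  with bR have "(\<forall>F. b F \<in> R) \<and> (\<forall>F\<subseteq>{..<n}. card F = p \<longrightarrow> c F - D n b F \<in> adj J y)"
    by simp
  then show "\<exists>b. (\<forall>F. b F \<in> R) \<and> (\<forall>F\<subseteq>{..<n}. card F = p \<longrightarrow> c F - D n b F \<in> adj J y)"
    by (rule exI[of _ b])
qed

text \<open>The constant cochain \<open>u\<close> is a cocycle in degree 0, and the only coboundary
  at the empty set is 0. This is what a socle element contradicts.\<close>

lemma vanish_0_no_socle: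
  assumes J: "ideal_in J" and "vanish 0 J" "u \<in> R" "\<And>i. i < n \<Longrightarrow> x i * u \<in> J"
  shows "u \<in> J"
proof -
  have Du: "D n (\<lambda>F. u) F \<in> J" if "F \<subseteq> {..<n}" "card F = Suc 0" for F
    using that assms(4) by (auto simp: card_1_singleton_iff D_singleton)
  obtain b where b0: "(\<forall>F. b F \<in> R) \<and> (\<forall>F\<subseteq>{..<n}. card F = 0 \<longrightarrow> u - D n b F \<in> J)"
    using vanishD[of 0 J "\<lambda>F. u", OF assms(2) assms(3) Du] ..
  have bR: "b F \<in> R" for F using b0 by blast
  have b: "u - D n b F \<in> J" if "F \<subseteq> {..<n}" "card F = 0" for F using b0 that by blast
  from b[of "{}"] show ?thesis by (simp add: D_empty)
qed

end

section \<open>Ideals of the polynomial ring and depth\<close>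

lemma poly_mapping_sum_single: "p = (\<Sum>a\<in>Poly_Mapping.keys p. Poly_Mapping.single a (Poly_Mapping.lookup p a))"
  by (rule poly_mapping_eqI) (auto simp: lookup_sum lookup_single when_def in_keys_iff)

text \<open>The additive extension of \<open>h\<close> to formal sums. It serves on two levels:
  \<open>push \<tau>\<close> renames the variables in an exponent vector, and
  \<open>push (push \<tau>)\<close> is the induced ring homomorphism.\<close>

definition push :: "('a \<Rightarrow> 'b) \<Rightarrow> ('a \<Rightarrow>\<^sub>0 'c) \<Rightarrow> 'b \<Rightarrow>\<^sub>0 'c::comm_monoid_add" where
  "push h p = (\<Sum>a\<in>Poly_Mapping.keys p. Poly_Mapping.single (h a) (Poly_Mapping.lookup p a))"

lemma push_superset:
  "finite A \<Longrightarrow> Poly_Mapping.keys p \<subseteq> A \<Longrightarrow> push h p = (\<Sum>a\<in>A. Poly_Mapping.single (h a) (Poly_Mapping.lookup p a))"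
  unfolding push_def by (rule sum.mono_neutral_left) (auto simp: in_keys_iff)

lemma push_zero [simp]: "push h 0 = 0"
  by (simp add: push_def)

lemma push_single [simp]: "push h (Poly_Mapping.single a c) = Poly_Mapping.single (h a) c"
  by (cases "c = 0") (auto simp: push_def)

lemma push_add: "push h (p + q) = push h p + push h q"
proof -
  let ?A = "Poly_Mapping.keys p \<union> Poly_Mapping.keys q"
  have "push h (p + q) = (\<Sum>a\<in>?A. Poly_Mapping.single (h a) (Poly_Mapping.lookup (p + q) a))"
    by (rule push_superset) (use keys_add[of p q] in auto)
  also have "\<dots> = push h p + push h q"
    by (simp add: push_superset[of ?A p] push_superset[of ?A q] lookup_add single_add sum.distrib)
  finally show ?thesis .
qed

lemma push_sum: "push h (\<Sum>i\<in>A. g i) = (\<Sum>i\<in>A. push h (g i))"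
  by (induction A rule: infinite_finite_induct) (auto simp: push_add)

lemma push_diff: "push h (p - q) = push h p - push h (q :: 'a \<Rightarrow>\<^sub>0 'c::ab_group_add)"
  using push_add[of h "p - q" q] by (simp add: algebra_simps)

lemma keys_push: "Poly_Mapping.keys (push h p) \<subseteq> h ` Poly_Mapping.keys p"
proof
  fix b assume "b \<in> Poly_Mapping.keys (push h p)"
  hence "(\<Sum>a\<in>Poly_Mapping.keys p. Poly_Mapping.lookup (Poly_Mapping.single (h a) (Poly_Mapping.lookup p a)) b) \<noteq> 0"
    by (simp add: push_def in_keys_iff lookup_sum)
  then obtain a where "a \<in> Poly_Mapping.keys p" "Poly_Mapping.lookup (Poly_Mapping.single (h a) (Poly_Mapping.lookup p a)) b \<noteq> 0"
    by (rule sum.not_neutral_contains_not_neutral)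
  then show "b \<in> h ` Poly_Mapping.keys p"
    by (auto simp: lookup_single when_def split: if_splits)
qed

lemma lookup_push:
  "finite {a. h a = b} \<Longrightarrow> Poly_Mapping.lookup (push h p) b = (\<Sum>a | h a = b. Poly_Mapping.lookup p a)"
proof -
  assume fin: "finite {a. h a = b}"
  have "Poly_Mapping.lookup (push h p) b = (\<Sum>a\<in>Poly_Mapping.keys p. if h a = b then Poly_Mapping.lookup p a else 0)"
    unfolding push_def lookup_sum by (rule sum.cong) (auto simp: lookup_single when_def)
  also have "\<dots> = (\<Sum>a\<in>Poly_Mapping.keys p \<inter> {a. h a = b}. Poly_Mapping.lookup p a)"
    by (simp add: sum.inter_restrict)
  also have "\<dots> = (\<Sum>a | h a = b. Poly_Mapping.lookup p a)"
    by (rule sum.mono_neutral_left) (use fin in \<open>auto simp: in_keys_iff\<close>)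
  finally show ?thesis .
qed

lemma push_mult:
  fixes p q :: "'a::monoid_add \<Rightarrow>\<^sub>0 'c::semiring_0"
  assumes h: "\<And>a b. h (a + b) = h a + h b"
  shows "push h (p * q) = push h p * push h q"
proof -
  have "push h (p * q) = push h ((\<Sum>a\<in>Poly_Mapping.keys p. Poly_Mapping.single a (Poly_Mapping.lookup p a)) *
     (\<Sum>b\<in>Poly_Mapping.keys q. Poly_Mapping.single b (Poly_Mapping.lookup q b)))"
    using poly_mapping_sum_single[of p] poly_mapping_sum_single[of q] by simp
  also have "\<dots> = push h p * push h q"
    by (simp add: push_def[of h p] push_def[of h q] sum_product mult_single push_sum h)
  finally show ?thesis .
qed

section \<open>Ideals of the polynomial ring\<close>

definition var :: "nat \<Rightarrow> 'k::field mpoly" where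
  "var v = monom1 (Poly_Mapping.single v 1)"

lemma polyringI: "(\<And>m. m \<in> Poly_Mapping.keys p \<Longrightarrow> Poly_Mapping.keys m \<subseteq> {..<n}) \<Longrightarrow> p \<in> polyring n"
  by (auto simp: polyring_def)

lemma polyringD: "p \<in> polyring n \<Longrightarrow> m \<in> Poly_Mapping.keys p \<Longrightarrow> Poly_Mapping.keys m \<subseteq> {..<n}"
  by (auto simp: polyring_def)

lemma keys_add_nat: "Poly_Mapping.keys (m + m') = Poly_Mapping.keys m \<union> Poly_Mapping.keys (m' :: 'a \<Rightarrow>\<^sub>0 nat)"
  by (auto simp: in_keys_iff lookup_add)

lemma single_in_polyring: "Poly_Mapping.keys m \<subseteq> {..<n} \<Longrightarrow> Poly_Mapping.single m c \<in> polyring n"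
  by (auto simp: polyring_def split: if_splits)

lemma var_in_polyring: "v < n \<Longrightarrow> var v \<in> polyring n"
  by (simp add: var_def monom1_def single_in_polyring)

interpretation polyring: koszul "polyring n :: 'k::field mpoly set" n var for n
proof
  show "0 \<in> polyring n" "1 \<in> polyring n"
    using single_in_polyring[of 0 n 0] single_in_polyring[of 0 n 1] by simp_all
  fix a b :: "'k mpoly" assume ab: "a \<in> polyring n" "b \<in> polyring n"
  show "a + b \<in> polyring n"
    using keys_add[of a b] polyringD[OF ab(1)] polyringD[OF ab(2)] by (intro polyringI) blast
  show "a * b \<in> polyring n"
  proof (rule polyringI)
    fix m assume "m \<in> Poly_Mapping.keys (a * b)"
    then obtain i j where "m = i + j" "i \<in> Poly_Mapping.keys a" "j \<in> Poly_Mapping.keys b"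
      using keys_mult[of a b] by auto
    then show "Poly_Mapping.keys m \<subseteq> {..<n}"
      using polyringD[OF ab(1)] polyringD[OF ab(2)] by (simp add: keys_add_nat)
  qed
next
  fix a :: "'k mpoly" assume "a \<in> polyring n"
  then show "- a \<in> polyring n" by (auto simp: polyring_def in_keys_iff)
next
  fix i assume "i < n"
  then show "(var i :: 'k mpoly) \<in> polyring n" by (rule var_in_polyring)
qed

lemma ideal_genE:
  assumes "p \<in> ideal_gen n G"
  obtains k :: nat and c g where "\<forall>i<k. c i \<in> polyring n \<and> g i \<in> G" "p = (\<Sum>i<k. c i * g i)"
  using assms unfolding ideal_gen_def mem_Collect_eq by (elim exE conjE) (rule that)

lemma ideal_gen_add_term:
  assumes "p \<in> ideal_gen n G" "c \<in> polyring n" "g \<in> G"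
  shows "p + c * g \<in> ideal_gen n G"
proof -
  obtain k :: nat and c' g' where *: "\<forall>i<k. c' i \<in> polyring n \<and> g' i \<in> G" "p = (\<Sum>i<k. c' i * g' i)"
    using assms(1) by (rule ideal_genE)
  have "p + c * g = (\<Sum>i<Suc k. (c'(k := c)) i * (g'(k := g)) i)"
    using *(2) by simp
  moreover have "\<forall>i<Suc k. (c'(k := c)) i \<in> polyring n \<and> (g'(k := g)) i \<in> G"
    using * assms by (auto simp: less_Suc_eq)
  ultimately show ?thesis unfolding ideal_gen_def by blast
qed

lemma ideal_gen_zero: "0 \<in> ideal_gen n G"
  unfolding ideal_gen_def by (auto intro!: exI[of _ "0::nat"])

lemma ideal_gen_superset: "G \<subseteq> ideal_gen n G"
  using ideal_gen_add_term[OF ideal_gen_zero polyring.one_in] by auto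

lemma ideal_gen_least: "polyring.ideal_in n K \<Longrightarrow> G \<subseteq> K \<Longrightarrow> ideal_gen n G \<subseteq> K"
  unfolding ideal_gen_def
  by (auto intro!: polyring.ideal_in_sum polyring.ideal_inD(4)[of n K])

lemma ideal_in_ideal_gen:
  assumes "G \<subseteq> polyring n"
  shows "polyring.ideal_in n (ideal_gen n G)"
proof -
  have "a + b \<in> ideal_gen n G" if a: "a \<in> ideal_gen n G" and b: "b \<in> ideal_gen n G" for a b
  proof -
    obtain k :: nat and c g where *: "\<forall>i<k. c i \<in> polyring n \<and> g i \<in> G" "b = (\<Sum>i<k. c i * g i)"
      using b by (rule ideal_genE)
    have "a + (\<Sum>i<j. c i * g i) \<in> ideal_gen n G" if "j \<le> k" for j
      using that
    proof (induction j)
      case (Suc j)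
      then show ?case
        using ideal_gen_add_term[of "a + (\<Sum>i<j. c i * g i)" n G "c j" "g j"] *
        by (simp add: add.assoc)
    qed (use a in simp)
    then show ?thesis using * by simp
  qed
  moreover have "r * a \<in> ideal_gen n G" if r: "r \<in> polyring n" and a: "a \<in> ideal_gen n G" for r a
  proof -
    obtain k :: nat and c g where *: "\<forall>i<k. c i \<in> polyring n \<and> g i \<in> G" "a = (\<Sum>i<k. c i * g i)"
      using a by (rule ideal_genE)
    have "r * a = (\<Sum>i<k. (r * c i) * g i)" by (simp add: * sum_distrib_left mult.assoc)
    moreover have "\<forall>i<k. r * c i \<in> polyring n \<and> g i \<in> G"
      using * r by (auto intro: polyring.mult_in)
    ultimately show ?thesis unfolding ideal_gen_def mem_Collect_eq
      by (intro exI[of _ k] exI[of _ "\<lambda>i. r * c i"] exI[of _ g]) auto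
  qed
  ultimately show ?thesis
    using ideal_gen_zero ideal_gen_least[OF polyring.ideal_in_R assms]
    unfolding polyring.ideal_in_def by auto
qed

text \<open>Translates the ideals in the definition of a regular sequence into the ideals
  \<open>adj\<close> of the Koszul lemmas.\<close>

lemma ideal_gen_insert:
  assumes "G \<subseteq> polyring n" "y \<in> polyring n"
  shows "ideal_gen n (insert y G) = polyring.adj n (ideal_gen n G) y"
proof
  note G = ideal_in_ideal_gen[OF assms(1)]
  note yG = ideal_in_ideal_gen[of "insert y G" n]
  show "ideal_gen n (insert y G) \<subseteq> polyring.adj n (ideal_gen n G) y"
  proof (rule ideal_gen_least)
    show "polyring.ideal_in n (polyring.adj n (ideal_gen n G) y)"
      by (rule polyring.ideal_in_adj[OF G assms(2)])
    have "y * 1 \<in> polyring.adj n (ideal_gen n G) y"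
      by (rule polyring.ideal_in_adj(3)[OF G assms(2) polyring.one_in])
    then show "insert y G \<subseteq> polyring.adj n (ideal_gen n G) y"
      using polyring.ideal_in_adj(2)[OF G assms(2)] ideal_gen_superset[of G n] by auto
  qed
  show "polyring.adj n (ideal_gen n G) y \<subseteq> ideal_gen n (insert y G)"
  proof
    fix q assume "q \<in> polyring.adj n (ideal_gen n G) y"
    then obtain e where e: "e \<in> polyring n" "q - y * e \<in> ideal_gen n G"
      by (auto simp: polyring.adj_def)
    have "ideal_gen n G \<subseteq> ideal_gen n (insert y G)"
      using ideal_gen_superset[of "insert y G" n] assms by (intro ideal_gen_least yG) auto
    then show "q \<in> ideal_gen n (insert y G)"
      using ideal_gen_add_term[of "q - y * e" n "insert y G" e y] e by (auto simp: mult.commute)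
  qed
qed

text \<open>Every monomial of \<open>y\<close> is nonconstant and hence divisible by a variable. The
  coefficients \<open>r\<close> are the ones that \<open>vanish_0\<close> and
  \<open>vanish_Suc\<close> ask for.\<close>

lemma max_hom_ideal_combination:
  assumes "y \<in> max_hom_ideal n"
  shows "\<exists>r. (\<forall>i<n. r i \<in> polyring n) \<and> y = (\<Sum>i<n. r i * var i)"
proof -
  define K :: "'a mpoly set" where "K = {y. \<exists>r. (\<forall>i<n. r i \<in> polyring n) \<and> y = (\<Sum>i<n. r i * var i)}"
  have add: "a + b \<in> K" if "a \<in> K" "b \<in> K" for a b
  proof -
    from that obtain r s where "\<forall>i<n. r i \<in> polyring n" "a = (\<Sum>i<n. r i * var i)"
      "\<forall>i<n. s i \<in> polyring n" "b = (\<Sum>i<n. s i * var i)" by (auto simp: K_def)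
    then show ?thesis unfolding K_def mem_Collect_eq
      by (intro exI[of _ "\<lambda>i. r i + s i"]) (auto simp: polyring.add_in sum.distrib distrib_right)
  qed
  have zero: "0 \<in> K"
    unfolding K_def mem_Collect_eq by (intro exI[of _ "\<lambda>i. 0"]) (auto simp: polyring.zero_in)
  have single: "Poly_Mapping.single m c \<in> K" if m: "m \<noteq> 0" "Poly_Mapping.keys m \<subseteq> {..<n}" for m c
  proof -
    obtain v where v: "v \<in> Poly_Mapping.keys m" using m(1) by (metis keys_eq_empty all_not_in_conv)
    define m' where "m' = m - Poly_Mapping.single v 1"
    have mm': "m = m' + Poly_Mapping.single v 1"
      using v by (intro poly_mapping_eqI) (auto simp: m'_def lookup_add lookup_minus lookup_single when_def in_keys_iff)
    have vn: "v < n" using v m(2) by auto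
    have "Poly_Mapping.keys m' \<subseteq> {..<n}" using m(2) unfolding mm' keys_add_nat by auto
    moreover have "Poly_Mapping.single m c = Poly_Mapping.single m' c * var v"
      by (simp add: mm' var_def monom1_def mult_single)
    moreover have "(\<Sum>i<n. (if i = v then Poly_Mapping.single m' c else 0) * var i)
        = Poly_Mapping.single m' c * var v"
      using vn by (subst sum.remove[of _ v]) (auto intro!: sum.neutral)
    ultimately show ?thesis unfolding K_def mem_Collect_eq
      by (intro exI[of _ "\<lambda>i. if i = v then Poly_Mapping.single m' c else 0"])
         (auto intro: single_in_polyring polyring.zero_in)
  qed
  have "finite A \<Longrightarrow> A \<subseteq> Poly_Mapping.keys y \<Longrightarrow>
      (\<Sum>m\<in>A. Poly_Mapping.single m (Poly_Mapping.lookup y m)) \<in> K" for A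
  proof (induction A rule: finite_induct)
    case (insert m A)
    have "m \<noteq> 0" "Poly_Mapping.keys m \<subseteq> {..<n}"
      using insert.prems assms polyringD[of y n m] by (auto simp: max_hom_ideal_def in_keys_iff)
    then show ?case using insert add single by auto
  qed (simp add: zero)
  from this[of "Poly_Mapping.keys y"] have "y \<in> K" using poly_mapping_sum_single[of y] by simp
  then show ?thesis by (simp add: K_def)
qed

section \<open>Regular sequences, Koszul cohomology and depth\<close>

lemma regular_seq_Cons:
  assumes "regular_seq n G (y # ys)"
  shows "y \<in> max_hom_ideal n"
    "\<And>p. p \<in> polyring n \<Longrightarrow> y * p \<in> ideal_gen n G \<Longrightarrow> p \<in> ideal_gen n G"
    "regular_seq n (insert y G) ys"
proof -
  note * = assms[unfolded regular_seq_def]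
  show "y \<in> max_hom_ideal n" using * by simp
  show "p \<in> ideal_gen n G" if "p \<in> polyring n" "y * p \<in> ideal_gen n G" for p
    using *[THEN conjunct2, THEN conjunct1, rule_format, of 0 p] that by simp
  have "p \<in> ideal_gen n (insert y G \<union> set (take i ys))"
    if "i < length ys" "p \<in> polyring n" "ys ! i * p \<in> ideal_gen n (insert y G \<union> set (take i ys))" for i p
    using *[THEN conjunct2, THEN conjunct1, rule_format, of "Suc i" p] that by simp
  then show "regular_seq n (insert y G) ys"
    using * unfolding regular_seq_def by simp
qed

lemma max_hom_ideal_subset: "max_hom_ideal n \<subseteq> polyring n"
  by (auto simp: max_hom_ideal_def)

text \<open>Each regular element moves vanishing modulo that element up by one degree; degree 0 is
  covered by regularity of the first element.\<close>

lemma regular_seq_vanish: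
  "regular_seq n G ys \<Longrightarrow> G \<subseteq> polyring n \<Longrightarrow> p < length ys \<Longrightarrow> polyring.vanish n p (ideal_gen n G)"
proof (induction ys arbitrary: G p)
  case (Cons y ys)
  note y = regular_seq_Cons[OF Cons.prems(1)]
  obtain r where r: "\<And>i. i < n \<Longrightarrow> r i \<in> polyring n" "y = (\<Sum>i<n. r i * var i)"
    using max_hom_ideal_combination[OF y(1)] by auto
  have yR: "y \<in> polyring n" using y(1) max_hom_ideal_subset by auto
  note J = ideal_in_ideal_gen[OF Cons.prems(2)]
  show ?case
  proof (cases p)
    case 0
    then show ?thesis using polyring.vanish_0[OF J r y(2)] by simp
  next
    case (Suc q)
    have "polyring.vanish n q (ideal_gen n (insert y G))"
      using Cons.prems Suc yR by (intro Cons.IH y(3)) auto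
    then show ?thesis
      using polyring.vanish_Suc[OF J r y(2)] ideal_gen_insert[OF Cons.prems(2) yR] Suc by simp
  qed
qed simp

text \<open>Dividing out a regular element costs one degree of vanishing, so after all of
  \<open>xs\<close> degree 0 is left.\<close>

lemma vanish_mod_regular_seq:
  "regular_seq n G xs \<Longrightarrow> G \<subseteq> polyring n \<Longrightarrow> (\<And>p. p \<le> length xs \<Longrightarrow> polyring.vanish n p (ideal_gen n G)) \<Longrightarrow>
     polyring.vanish n 0 (ideal_gen n (G \<union> set xs))"
proof (induction xs arbitrary: G)
  case (Cons x xs)
  note x = regular_seq_Cons[OF Cons.prems(1)]
  have xR: "x \<in> polyring n" using x(1) max_hom_ideal_subset by auto
  note J = ideal_in_ideal_gen[OF Cons.prems(2)]
  have "polyring.vanish n p (ideal_gen n (insert x G))" if "p \<le> length xs" for p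
    unfolding ideal_gen_insert[OF Cons.prems(2) xR]
    using that by (intro polyring.vanish_adj[OF J xR x(2)] Cons.prems(3)) auto
  then show ?case using Cons.IH[OF x(3)] Cons.prems(2) xR by simp
qed simp

text \<open>A sequence \<open>ys\<close> longer than \<open>xs\<close> would make the cohomology
  vanish in all degrees up to \<open>length xs\<close>, hence in degree 0 modulo \<open>xs\<close>,
  where the socle element \<open>u\<close> is a nonzero class.\<close>

lemma depth_quot_eqI:
  assumes I: "polyring.ideal_in n I" and xs: "regular_seq n I xs"
    and u: "u \<in> polyring n" "u \<notin> ideal_gen n (I \<union> set xs)"
    and socle: "\<And>i. i < n \<Longrightarrow> var i * u \<in> ideal_gen n (I \<union> set xs)"
  shows "depth_quot n I = enat (length xs)"
proof -
  have IR: "I \<subseteq> polyring n" using polyring.ideal_inD(1)[OF I] .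
  have xsR: "set xs \<subseteq> polyring n" using xs max_hom_ideal_subset by (auto simp: regular_seq_def)
  have "I \<noteq> polyring n"
    using u ideal_gen_superset[of "I \<union> set xs" n] by auto
  moreover have "length ys \<le> length xs" if ys: "regular_seq n I ys" for ys
  proof (rule ccontr)
    assume "\<not> length ys \<le> length xs"
    hence "polyring.vanish n p (ideal_gen n I)" if "p \<le> length xs" for p
      using that by (intro regular_seq_vanish[OF ys IR]) auto
    hence "polyring.vanish n 0 (ideal_gen n (I \<union> set xs))"
      by (rule vanish_mod_regular_seq[OF xs IR])
    moreover have "polyring.ideal_in n (ideal_gen n (I \<union> set xs))"
      using IR xsR by (intro ideal_in_ideal_gen) auto
    ultimately have "u \<in> ideal_gen n (I \<union> set xs)"
      using polyring.vanish_0_no_socle[of n "ideal_gen n (I \<union> set xs)" u] u(1) socle by blast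
    then show False using u(2) by simp
  qed
  then have "Sup {enat (length ys) | ys. regular_seq n I ys} = enat (length xs)"
    using xs by (intro antisym Sup_least Sup_upper) auto
  ultimately show ?thesis by (simp add: depth_quot_def)
qed

section \<open>Monomial ideals and identification of variables\<close>

definition mon_span :: "nat \<Rightarrow> (nat \<Rightarrow>\<^sub>0 nat) set \<Rightarrow> 'k::field mpoly set" where
  "mon_span n U = {p \<in> polyring n. Poly_Mapping.keys p \<subseteq> U}"

lemma mon_span_mult:
  assumes "\<And>m m'. m \<in> U \<Longrightarrow> m' \<in> U' \<Longrightarrow> m + m' \<in> V" "p \<in> mon_span n U" "q \<in> mon_span n U'"
  shows "p * q \<in> mon_span n V"
  using assms keys_mult[of p q] by (fastforce simp: mon_span_def intro: polyring.mult_in)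

lemma ideal_in_mon_span:
  assumes up: "\<And>m m'. m \<in> U \<Longrightarrow> m + m' \<in> U"
  shows "polyring.ideal_in n (mon_span n U :: 'k::field mpoly set)"
proof -
  have "a + b \<in> mon_span n U" if "a \<in> mon_span n U" "b \<in> mon_span n U" for a b :: "'k mpoly"
    using that keys_add[of a b] by (auto simp: mon_span_def intro: polyring.add_in)
  moreover have "r * a \<in> mon_span n U" if "r \<in> polyring n" "a \<in> mon_span n U" for r a :: "'k mpoly"
  proof (rule mon_span_mult)
    show "r \<in> mon_span n UNIV" using that by (simp add: mon_span_def)
    show "m + m' \<in> U" if "m' \<in> U" for m m' using up[OF that, of m] by (simp add: add.commute)
  qed (use that in simp)
  moreover have "mon_span n U \<subseteq> polyring n" "(0 :: 'k mpoly) \<in> mon_span n U"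
    by (auto simp: mon_span_def polyring.zero_in)
  ultimately show ?thesis
    by (auto simp: polyring.ideal_in_def)
qed

lemma mem_ideal_singles:
  assumes "polyring.ideal_in n J"
    and "\<And>m. m \<in> Poly_Mapping.keys p \<Longrightarrow> Poly_Mapping.single m (Poly_Mapping.lookup p m) \<in> J"
  shows "p \<in> J"
  using polyring.ideal_in_sum[OF assms(1), of "Poly_Mapping.keys p" "\<lambda>m. Poly_Mapping.single m (Poly_Mapping.lookup p m)"]
    assms(2) poly_mapping_sum_single[of p] by simp

lemma monomial_ideal_mon_span:
  assumes up: "\<And>m m'. m \<in> U \<Longrightarrow> m + m' \<in> U"
  shows "monomial_ideal n (mon_span n U)"
  unfolding monomial_ideal_def
proof (intro exI conjI)
  let ?M = "{m \<in> U. Poly_Mapping.keys m \<subseteq> {..<n}}"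
  show "\<forall>m\<in>?M. Poly_Mapping.keys m \<subseteq> {..<n}" by simp
  have sub: "monom1 ` ?M \<subseteq> polyring n" by (auto simp: monom1_def intro!: single_in_polyring)
  show "mon_span n U = ideal_gen n (monom1 ` ?M)"
  proof
    show "ideal_gen n (monom1 ` ?M) \<subseteq> mon_span n U"
      by (rule ideal_gen_least[OF ideal_in_mon_span[OF up]])
        (auto simp: mon_span_def monom1_def intro!: single_in_polyring)
    show "mon_span n U \<subseteq> ideal_gen n (monom1 ` ?M)"
    proof
      fix p assume p: "p \<in> mon_span n U"
      show "p \<in> ideal_gen n (monom1 ` ?M)"
      proof (rule mem_ideal_singles[OF ideal_in_ideal_gen[OF sub]])
        fix m assume "m \<in> Poly_Mapping.keys p"
        hence "monom1 m \<in> monom1 ` ?M" using p polyringD[of p n m] by (auto simp: mon_span_def)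
        from ideal_gen_add_term[OF ideal_gen_zero single_in_polyring[of 0 n "Poly_Mapping.lookup p m"] this]
        show "Poly_Mapping.single m (Poly_Mapping.lookup p m) \<in> ideal_gen n (monom1 ` ?M)"
          by (simp add: monom1_def mult_single)
      qed
    qed
  qed
qed

text \<open>Compatibility of the family \<open>U\<close> with addition bounds the power from above;
  splitting off one element of \<open>U (Suc 0)\<close> at a time writes each monomial as a product
  of \<open>t\<close> elements of the ideal and a cofactor.\<close>

lemma ideal_pow_mon_span:
  assumes up: "\<And>t m m'. m \<in> U t \<Longrightarrow> m + m' \<in> U t"
    and U0: "U 0 = UNIV"
    and add: "\<And>t m m'. m \<in> U (Suc 0) \<Longrightarrow> m' \<in> U t \<Longrightarrow> m + m' \<in> U (Suc t)"
    and split: "\<And>t m. m \<in> U (Suc t) \<Longrightarrow> Poly_Mapping.keys m \<subseteq> {..<n} \<Longrightarrow>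
       \<exists>m1\<in>U (Suc 0). \<exists>m2\<in>U t. m = m1 + m2"
  shows "ideal_pow n (mon_span n (U (Suc 0)) :: 'k::field mpoly set) t = mon_span n (U t)"
proof
  let ?Q = "mon_span n (U (Suc 0)) :: 'k mpoly set"
  let ?P = "{prod_list xs | xs. length xs = t \<and> set xs \<subseteq> ?Q}"
  have prod: "set xs \<subseteq> ?Q \<Longrightarrow> prod_list xs \<in> mon_span n (U (length xs))" for xs
  proof (induction xs)
    case (Cons x xs)
    then show ?case
      using mon_span_mult[where U = "U (Suc 0)" and U' = "U (length xs)" and p = x and q = "prod_list xs", OF add]
      by simp
  qed (simp add: mon_span_def polyring.one_in U0)
  have P: "?P \<subseteq> mon_span n (U t)" using prod by auto
  then show "ideal_pow n ?Q t \<subseteq> mon_span n (U t)"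
    unfolding ideal_pow_def by (intro ideal_gen_least ideal_in_mon_span up)
  \<comment> \<open>The factors in \<open>xs\<close> are monic monomials; the scalar
    \<open>c\<close> and the surplus exponents end up in the cofactor \<open>m0\<close>.\<close>
  have factor: "\<exists>xs m0. length xs = t \<and> set xs \<subseteq> ?Q \<and> Poly_Mapping.keys m0 \<subseteq> {..<n} \<and>
      Poly_Mapping.single m c = Poly_Mapping.single m0 c * prod_list xs"
    if "m \<in> U t" "Poly_Mapping.keys m \<subseteq> {..<n}" for m c t
    using that
  proof (induction t arbitrary: m)
    case 0
    then show ?case by (intro exI[of _ "[]"] exI[of _ m]) auto
  next
    case (Suc t)
    obtain m1 m2 where m: "m1 \<in> U (Suc 0)" "m2 \<in> U t" "m = m1 + m2"
      using split[OF Suc.prems] by auto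
    hence keys: "Poly_Mapping.keys m1 \<subseteq> {..<n}" "Poly_Mapping.keys m2 \<subseteq> {..<n}"
      using Suc.prems(2) by (auto simp: keys_add_nat)
    obtain xs m0 where xs: "length xs = t" "set xs \<subseteq> ?Q" "Poly_Mapping.keys m0 \<subseteq> {..<n}"
      "Poly_Mapping.single m2 c = Poly_Mapping.single m0 c * prod_list xs"
      using Suc.IH[OF m(2) keys(2)] by auto
    have "Poly_Mapping.single m c = Poly_Mapping.single m0 c * prod_list (monom1 m1 # xs)"
    proof -
      have "Poly_Mapping.single m c = monom1 m1 * Poly_Mapping.single m2 c"
        by (simp add: m(3) monom1_def mult_single)
      then show ?thesis by (simp add: xs(4) mult.left_commute)
    qed
    moreover have "monom1 m1 \<in> ?Q"
      using m(1) keys(1) by (auto simp: mon_span_def monom1_def intro: single_in_polyring)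
    ultimately show ?case using xs by (intro exI[of _ "monom1 m1 # xs"] exI[of _ m0]) auto
  qed
  show "mon_span n (U t) \<subseteq> ideal_pow n ?Q t"
  proof
    fix p :: "'k mpoly" assume p: "p \<in> mon_span n (U t)"
    have "?P \<subseteq> polyring n" using P by (auto simp: mon_span_def)
    from ideal_in_ideal_gen[OF this] show "p \<in> ideal_pow n ?Q t"
      unfolding ideal_pow_def
    proof (rule mem_ideal_singles)
      fix m assume m: "m \<in> Poly_Mapping.keys p"
      have "m \<in> U t" "Poly_Mapping.keys m \<subseteq> {..<n}"
        using m p polyringD[of p n m] by (auto simp: mon_span_def)
      from factor[OF this, of "Poly_Mapping.lookup p m"]
      obtain xs m0 where xs: "length xs = t" "set xs \<subseteq> ?Q" "Poly_Mapping.keys m0 \<subseteq> {..<n}"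
        "Poly_Mapping.single m (Poly_Mapping.lookup p m) = Poly_Mapping.single m0 (Poly_Mapping.lookup p m) * prod_list xs"
        by blast
      have "prod_list xs \<in> ?P" using xs by auto
      from ideal_gen_add_term[OF ideal_gen_zero single_in_polyring[OF xs(3)] this]
      show "Poly_Mapping.single m (Poly_Mapping.lookup p m) \<in> ideal_gen n ?P"
        unfolding xs(4) by simp
    qed
  qed
qed

section \<open>Identification of variables\<close>

lemma push_add_distrib:
  "push (push \<tau>) (p * q) = push (push \<tau>) p * push (push \<tau>) (q :: 'k::field mpoly)"
  by (rule push_mult) (rule push_add)

lemma push_var: "push (push \<tau>) (var v) = var (\<tau> v)"
  by (simp add: var_def monom1_def)

lemma keys_push_subset:
  assumes "Poly_Mapping.keys m \<subseteq> {..<n}" "\<And>v. v < n \<Longrightarrow> \<tau> v < n"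
  shows "Poly_Mapping.keys (push \<tau> m) \<subseteq> {..<n}"
  using keys_push[of \<tau> m] assms by fastforce

text \<open>Induction on the degree, replacing one variable at a time: for \<open>m = v m'\<close>
  the difference is \<open>v (m' - \<tau> m') + \<tau> m' (v - \<tau> v)\<close>.\<close>

lemma single_minus_push:
  fixes c :: "'k::field"
  assumes J: "polyring.ideal_in n J"
    and \<tau>: "\<And>v. v < n \<Longrightarrow> \<tau> v < n" and var: "\<And>v. v < n \<Longrightarrow> var v - var (\<tau> v) \<in> J"
    and "Poly_Mapping.keys m \<subseteq> {..<n}"
  shows "Poly_Mapping.single m c - Poly_Mapping.single (push \<tau> m) c \<in> J"
proof -
  have "Poly_Mapping.single m (1::'k) - Poly_Mapping.single (push \<tau> m) 1 \<in> J"
    if "Poly_Mapping.keys m \<subseteq> {..<n}" "d = (\<Sum>v<n. Poly_Mapping.lookup m v)" for m d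
    using that
  proof (induction d arbitrary: m)
    case 0
    hence "Poly_Mapping.lookup m v = 0" for v
      by (cases "v < n") (auto simp: in_keys_iff subset_iff)
    hence "m = 0" by (intro poly_mapping_eqI) simp
    then show ?case using polyring.ideal_inD(2)[OF J] by simp
  next
    case (Suc d)
    then obtain v where v: "v < n" "Poly_Mapping.lookup m v \<noteq> 0"
      by (metis lessThan_iff nat.distinct(1) sum.neutral)
    define m' where "m' = m - Poly_Mapping.single v 1"
    have m: "m = Poly_Mapping.single v 1 + m'"
      using v by (intro poly_mapping_eqI) (auto simp: m'_def lookup_add lookup_minus lookup_single when_def)
    have keys: "Poly_Mapping.keys m' \<subseteq> {..<n}" using Suc.prems(1) by (simp add: m keys_add_nat)
    have "(\<Sum>i<n. Poly_Mapping.lookup m i) = Suc (\<Sum>i<n. Poly_Mapping.lookup m' i)"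
      using v(1) by (simp add: m lookup_add sum.distrib lookup_single when_def)
    hence IH: "Poly_Mapping.single m' (1::'k) - Poly_Mapping.single (push \<tau> m') 1 \<in> J"
      using Suc.prems(2) by (intro Suc.IH keys) simp
    have "Poly_Mapping.single m (1::'k) - Poly_Mapping.single (push \<tau> m) 1
       = var v * (Poly_Mapping.single m' 1 - Poly_Mapping.single (push \<tau> m') 1)
         + Poly_Mapping.single (push \<tau> m') 1 * (var v - var (\<tau> v))"
      by (simp add: m push_add var_def monom1_def algebra_simps mult_single)
    also have "\<dots> \<in> J"
      using v(1) by (intro polyring.ideal_inD(3)[OF J] polyring.ideal_inD(4)[OF J] IH var
        var_in_polyring single_in_polyring keys_push_subset keys \<tau>)
    finally show ?case .
  qed
  from polyring.ideal_inD(4)[OF J single_in_polyring[of 0 n c] this[OF assms(4) refl]]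
  show ?thesis by (simp add: algebra_simps mult_single)
qed

text \<open>Modulo the differences every monomial is congruent to its image under
  \<open>\<tau>\<close>, so membership can be tested on that image. \<open>U'\<close> is the
  saturation of \<open>U\<close> under the identification, and \<open>lift\<close> says that it is
  not larger.\<close>

lemma ideal_gen_glue:
  fixes \<tau> :: "nat \<Rightarrow> nat" and U U' :: "(nat \<Rightarrow>\<^sub>0 nat) set"
  assumes idem: "\<And>v. \<tau> (\<tau> v) = \<tau> v" and \<tau>: "\<And>v. v < n \<Longrightarrow> \<tau> v < n"
    and V: "V \<subseteq> {..<n}" "\<And>v. v \<notin> V \<Longrightarrow> \<tau> v = v"
    and sub: "U \<subseteq> U'" and up: "\<And>m m'. m \<in> U' \<Longrightarrow> m + m' \<in> U'"
    and inv: "\<And>m. push \<tau> m \<in> U' \<longleftrightarrow> m \<in> U'"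
    and lift: "\<And>m. m \<in> U' \<Longrightarrow> Poly_Mapping.keys m \<subseteq> {..<n} \<Longrightarrow>
       \<exists>u\<in>U. Poly_Mapping.keys u \<subseteq> {..<n} \<and> push \<tau> u = push \<tau> m"
  shows "ideal_gen n (mon_span n U \<union> (\<lambda>v. var v - var (\<tau> v)) ` V)
       = {p \<in> polyring n. Poly_Mapping.keys (push (push \<tau>) p) \<subseteq> U'}" (is "ideal_gen n ?G = ?K")
proof
  have keys\<phi>: "Poly_Mapping.keys (push (push \<tau>) p) \<subseteq> U'" if "Poly_Mapping.keys p \<subseteq> U'" for p :: "'k::field mpoly"
    using keys_push[of "push \<tau>" p] that inv by auto
  have varG: "var v - var (\<tau> v) \<in> polyring n" if "v < n" for v
    using that by (intro polyring.ideal_in_diff[OF polyring.ideal_in_R] var_in_polyring \<tau>)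
  show "ideal_gen n ?G \<subseteq> ?K"
  proof (rule ideal_gen_least)
    have "a + b \<in> ?K" if "a \<in> ?K" "b \<in> ?K" for a b
      using that keys_add[of "push (push \<tau>) a" "push (push \<tau>) b"]
      by (auto simp: push_add intro: polyring.add_in)
    moreover have "r * a \<in> ?K" if "r \<in> polyring n" "a \<in> ?K" for r a
      using that keys_mult[of "push (push \<tau>) r" "push (push \<tau>) a"] up
      by (fastforce simp: push_add_distrib add.commute intro: polyring.mult_in)
    ultimately show "polyring.ideal_in n ?K"
      by (auto simp: polyring.ideal_in_def polyring.zero_in)
    have "mon_span n U \<subseteq> ?K" using keys\<phi> sub by (auto simp: mon_span_def)
    moreover have "var v - var (\<tau> v) \<in> ?K" if "v \<in> V" for v
      using that V(1) varG[of v] by (auto simp: push_diff push_var idem)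
    ultimately show "?G \<subseteq> ?K" by auto
  qed
  have J: "polyring.ideal_in n (ideal_gen n ?G)"
    using V(1) varG by (intro ideal_in_ideal_gen) (auto simp: mon_span_def)
  have varJ: "var v - var (\<tau> v) \<in> ideal_gen n ?G" for v
  proof (cases "v \<in> V")
    case True
    then show ?thesis using ideal_gen_superset[of ?G n] by auto
  qed (simp add: V(2) ideal_gen_zero)
  note sp = single_minus_push[OF J \<tau> varJ]
  show "?K \<subseteq> ideal_gen n ?G"
  proof
    fix p assume p: "p \<in> ?K"
    \<comment> \<open>Each monomial of the image is congruent to a monomial of \<open>U\<close> with
      the same image; the remainder \<open>p - push (push \<tau>) p\<close> is a combination of
      differences.\<close>
    have "push (push \<tau>) p \<in> ideal_gen n ?G"
    proof (rule mem_ideal_singles[OF J])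
      fix k assume k: "k \<in> Poly_Mapping.keys (push (push \<tau>) p)"
      let ?c = "Poly_Mapping.lookup (push (push \<tau>) p) k"
      obtain m where m: "m \<in> Poly_Mapping.keys p" "k = push \<tau> m" using k keys_push[of "push \<tau>" p] by auto
      have "m \<in> U'" using k p m(2) inv by auto
      moreover have "Poly_Mapping.keys m \<subseteq> {..<n}" using m(1) p polyringD by blast
      ultimately obtain u where u: "u \<in> U" "Poly_Mapping.keys u \<subseteq> {..<n}" "push \<tau> u = k"
        using lift m(2) by blast
      have "Poly_Mapping.single u ?c \<in> ?G"
        using u single_in_polyring[OF u(2)] by (auto simp: mon_span_def polyring.zero_in)
      hence "Poly_Mapping.single u ?c \<in> ideal_gen n ?G" using ideal_gen_superset[of ?G n] by blast
      from polyring.ideal_in_diff[OF J this sp[OF _ u(2), of ?c]] show "Poly_Mapping.single k ?c \<in> ideal_gen n ?G"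
        by (simp add: u(3))
    qed
    moreover have "p - push (push \<tau>) p \<in> ideal_gen n ?G"
    proof -
      have "p - push (push \<tau>) p = (\<Sum>m\<in>Poly_Mapping.keys p.
          Poly_Mapping.single m (Poly_Mapping.lookup p m) - Poly_Mapping.single (push \<tau> m) (Poly_Mapping.lookup p m))"
        using poly_mapping_sum_single[of p] by (simp add: sum_subtractf push_def[of "push \<tau>"])
      also have "\<dots> \<in> ideal_gen n ?G"
        using p polyringD[of p n] by (intro polyring.ideal_in_sum[OF J] sp) auto
      finally show ?thesis .
    qed
    ultimately show "p \<in> ideal_gen n ?G" using polyring.ideal_inD(3)[OF J] by fastforce
  qed
qed

section \<open>Regularity of the difference of two variables\<close>

lemma lookup_single_mult:
  fixes p :: "'a::cancel_comm_monoid_add \<Rightarrow>\<^sub>0 'b::semiring_0"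
  shows "Poly_Mapping.lookup (Poly_Mapping.single a c * p) (a + b) = c * Poly_Mapping.lookup p b"
proof -
  have "Poly_Mapping.single a c * p = (\<Sum>b\<in>Poly_Mapping.keys p. Poly_Mapping.single (a + b) (c * Poly_Mapping.lookup p b))"
    by (subst poly_mapping_sum_single[of p]) (simp add: sum_distrib_left mult_single)
  then show ?thesis
    by (auto simp: lookup_sum lookup_single when_def in_keys_iff)
qed

text \<open>If \<open>m\<close> has a nonzero coefficient in \<open>P\<close> and \<open>m y\<close> is not in \<open>U\<close>, then \<open>m y\<close> must cancel in \<open>(z - y) P\<close>,
  so \<open>m y / z\<close> also has a nonzero coefficient in \<open>P\<close>; this cannot go on forever.\<close>

lemma difference_chain:
  fixes P :: "'k::field mpoly"
  assumes yz: "y \<noteq> z" and up: "\<And>m m'. m \<in> U \<Longrightarrow> m + m' \<in> U"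
    and keys: "Poly_Mapping.keys ((var z - var y) * P) \<subseteq> U"
    and "Poly_Mapping.lookup P m \<noteq> 0" "\<And>j. m + Poly_Mapping.single y j \<notin> U"
  shows False
proof -
  let ?y = "Poly_Mapping.single y 1" and ?z = "Poly_Mapping.single z (1::nat)"
  show False using assms(4,5)
  proof (induction "Poly_Mapping.lookup m z" arbitrary: m rule: less_induct)
    case less
    have "m + ?y \<notin> U" using less.prems(2)[of 1] .
    hence "Poly_Mapping.lookup ((var z - var y) * P) (?y + m) = 0"
      using keys by (auto simp: in_keys_iff add.commute)
    hence "Poly_Mapping.lookup (var z * P) (?y + m) = Poly_Mapping.lookup P m"
      by (simp add: left_diff_distrib lookup_minus var_def monom1_def lookup_single_mult)
    moreover from this have "?y + m \<in> Poly_Mapping.keys (var z * P)"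
      using less.prems(1) by (simp add: in_keys_iff)
    then obtain m1 where m1: "?y + m = ?z + m1"
      using keys_mult[of "var z :: 'k mpoly" P] by (auto simp: var_def monom1_def)
    ultimately have "Poly_Mapping.lookup P m1 \<noteq> 0"
      using less.prems(1) by (simp add: var_def monom1_def lookup_single_mult)
    moreover have "Poly_Mapping.lookup m1 z < Poly_Mapping.lookup m z"
      using arg_cong[OF m1, of "\<lambda>m. Poly_Mapping.lookup m z"] yz by (simp add: lookup_add lookup_single when_def)
    moreover have "m1 + Poly_Mapping.single y j \<notin> U" for j
    proof
      assume "m1 + Poly_Mapping.single y j \<in> U"
      hence "m1 + Poly_Mapping.single y j + ?z \<in> U" by (rule up)
      also have "m1 + Poly_Mapping.single y j + ?z = m + Poly_Mapping.single y (1 + j)"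
      proof -
        have "m1 + Poly_Mapping.single y j + ?z = (?z + m1) + Poly_Mapping.single y j"
          by (simp add: add_ac)
        also have "\<dots> = m + (?y + Poly_Mapping.single y j)"
          unfolding m1[symmetric] by (simp add: add_ac)
        finally show ?thesis by (simp flip: single_add)
      qed
      finally show False using less.prems(2) by blast
    qed
    ultimately show False using less.hyps by blast
  qed
qed

text \<open>If a monomial \<open>m\<close> of \<open>P\<close> were outside \<open>U\<close>,
  \<open>difference_chain\<close>, applied to both orders of \<open>y\<close> and \<open>z\<close>,
  would put some \<open>m y^i\<close> and some \<open>m z^j\<close> into \<open>U\<close>. Induction
  on \<open>i + j\<close> reduces this to \<open>W\<close>, the equality of
  \<open>(U : y) \<inter> (U : z)\<close> with \<open>U\<close>, and forces \<open>m\<close> into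
  \<open>U\<close>.\<close>

lemma difference_regular:
  fixes P :: "'k::field mpoly"
  assumes yz: "y \<noteq> z" and up: "\<And>m m'. m \<in> U \<Longrightarrow> m + m' \<in> U"
    and W: "\<And>m. m + Poly_Mapping.single y 1 \<in> U \<Longrightarrow> m + Poly_Mapping.single z 1 \<in> U \<Longrightarrow> m \<in> U"
    and keys: "Poly_Mapping.keys ((var z - var y) * P) \<subseteq> U"
  shows "Poly_Mapping.keys P \<subseteq> U"
proof (rule ccontr)
  assume "\<not> Poly_Mapping.keys P \<subseteq> U"
  then obtain m where m: "Poly_Mapping.lookup P m \<noteq> 0" "m \<notin> U" by (auto simp: in_keys_iff)
  have "(var y - var z) * P = - ((var z - var y) * P)" by (simp add: algebra_simps)
  hence keys': "Poly_Mapping.keys ((var y - var z) * P) \<subseteq> U" using keys by simp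
  obtain i where i: "m + Poly_Mapping.single y i \<in> U"
    using difference_chain[OF yz up keys m(1)] by blast
  obtain j where j: "m + Poly_Mapping.single z j \<in> U"
    using difference_chain[OF yz[symmetric] up keys' m(1)] by blast
  have "m + Poly_Mapping.single y i \<in> U \<Longrightarrow> m + Poly_Mapping.single z j \<in> U \<Longrightarrow> m \<in> U" for m i j
  proof (induction "i + j" arbitrary: m i j rule: less_induct)
    case less
    show ?case
    proof (cases i)
      case 0
      then show ?thesis using less.prems by simp
    next
      case (Suc i')
      show ?thesis
      proof (cases j)
        case 0
        then show ?thesis using less.prems by simp
      next
        case j: (Suc j')
        have "m + Poly_Mapping.single y 1 \<in> U"
        proof (rule less.hyps[of i' j])
          show "m + Poly_Mapping.single y 1 + Poly_Mapping.single y i' \<in> U"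
            using less.prems(1) by (simp add: Suc add.assoc flip: single_add)
          show "m + Poly_Mapping.single y 1 + Poly_Mapping.single z j \<in> U"
            using up[OF less.prems(2), of "Poly_Mapping.single y 1"] by (simp add: add_ac)
        qed (simp add: Suc)
        moreover have "m + Poly_Mapping.single z 1 \<in> U"
        proof (rule less.hyps[of i j'])
          show "m + Poly_Mapping.single z 1 + Poly_Mapping.single z j' \<in> U"
            using less.prems(2) by (simp add: j add.assoc flip: single_add)
          show "m + Poly_Mapping.single z 1 + Poly_Mapping.single y i \<in> U"
            using up[OF less.prems(1), of "Poly_Mapping.single z 1"] by (simp add: add_ac)
        qed (simp add: j)
        ultimately show ?thesis by (rule W)
      qed
    qed
  qed
  then show False using i j m(2) by blast
qed

section \<open>Products of ideals sharing one variable\<close>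

text \<open>The arguments of a region are the exponents of \<open>x\<close>, \<open>y\<close>, \<open>z\<close> and \<open>w\<close>; the region itself is the set of
  monomials of a monomial ideal.\<close>

type_synonym region = "nat \<Rightarrow> nat \<Rightarrow> nat \<Rightarrow> nat \<Rightarrow> bool"

text \<open>The monomials of the \<open>t\<close>-th power of the ideal whose generators have
  exponents \<open>G\<close>, with one generator split off per step.\<close>

primrec power_block :: "(nat \<times> nat \<times> nat \<times> nat) set \<Rightarrow> nat \<Rightarrow> region" where
  "power_block G 0 a b c d \<longleftrightarrow> True"
| "power_block G (Suc t) a b c d \<longleftrightarrow> (\<exists>a1 b1 c1 d1. (a1, b1, c1, d1) \<in> G \<and>
     a1 \<le> a \<and> b1 \<le> b \<and> c1 \<le> c \<and> d1 \<le> d \<and> power_block G t (a - a1) (b - b1) (c - c1) (d - d1))"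

text \<open>The image of the ideal under the identification of \<open>z\<close> with \<open>y\<close>.\<close>

definition glue :: "region \<Rightarrow> region" where
  "glue B a b c d \<longleftrightarrow> (\<exists>i j. i + j = b + c \<and> B a i j d)"

definition upclosed :: "region \<Rightarrow> bool" where
  "upclosed B \<longleftrightarrow> (\<forall>a b c d a' b' c' d'. B a b c d \<longrightarrow> a \<le> a' \<longrightarrow> b \<le> b' \<longrightarrow> c \<le> c' \<longrightarrow> d \<le> d' \<longrightarrow> B a' b' c' d')"

definition socle_point :: "region \<Rightarrow> nat \<Rightarrow> nat \<Rightarrow> nat \<Rightarrow> nat \<Rightarrow> bool" where
  "socle_point B a b c d \<longleftrightarrow> \<not> B a b c d \<and>
     B (Suc a) b c d \<and> B a (Suc b) c d \<and> B a b (Suc c) d \<and> B a b c (Suc d)"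

text \<open>\<open>v t\<close> is the depth of the quotient by the \<open>t\<close>-th power.\<close>

definition good_block :: "(nat \<times> nat \<times> nat \<times> nat) set \<Rightarrow> (nat \<Rightarrow> nat) \<Rightarrow> bool" where
  "good_block G v \<longleftrightarrow> (\<forall>t\<ge>1.
     v t = 0 \<and> (\<exists>a b c d. socle_point (power_block G t) a b c d) \<or>
     v t = 1 \<and> (\<forall>a b c d. power_block G t a (Suc b) c d \<longrightarrow> power_block G t a b (Suc c) d \<longrightarrow> power_block G t a b c d)
       \<and> (\<exists>a b c d. socle_point (glue (power_block G t)) a b c d))"

lemma upclosedD:
  assumes "upclosed B" "B a b c d" "a \<le> a'" "b \<le> b'" "c \<le> c'" "d \<le> d'"
  shows "B a' b' c' d'"
  by (rule assms(1)[unfolded upclosed_def, rule_format, OF assms(2-6)])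

lemma upclosed_power_block: "upclosed (power_block G t)"
proof (induction t)
  case 0
  show ?case by (simp add: upclosed_def)
next
  case (Suc t)
  show ?case
    unfolding upclosed_def
  proof (intro allI impI)
    fix a b c d a' b' c' d' :: nat
    assume "power_block G (Suc t) a b c d" and le: "a \<le> a'" "b \<le> b'" "c \<le> c'" "d \<le> d'"
    then obtain a1 b1 c1 d1 where *: "(a1, b1, c1, d1) \<in> G" "a1 \<le> a" "b1 \<le> b" "c1 \<le> c" "d1 \<le> d"
      "power_block G t (a - a1) (b - b1) (c - c1) (d - d1)" by auto
    moreover have "power_block G t (a' - a1) (b' - b1) (c' - c1) (d' - d1)"
      using le by - (rule upclosedD[OF Suc.IH *(6)]; simp)
    ultimately show "power_block G (Suc t) a' b' c' d'"
      unfolding power_block.simps using le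
      by (intro exI[of _ a1] exI[of _ b1] exI[of _ c1] exI[of _ d1]) simp
  qed
qed

lemma upclosed_glue:
  assumes "upclosed B" shows "upclosed (glue B)"
  unfolding upclosed_def
proof (intro allI impI)
  fix a b c d a' b' c' d' :: nat
  assume "glue B a b c d" and le: "a \<le> a'" "b \<le> b'" "c \<le> c'" "d \<le> d'"
  then obtain i j where "i + j = b + c" "B a i j d" by (auto simp: glue_def)
  moreover from this have "B a' (i + (b' + c' - (b + c))) j d'"
    using le by - (rule upclosedD[OF assms, of a i j d]; simp)
  ultimately show "glue B a' b' c' d'"
    unfolding glue_def using le by (intro exI[of _ "i + (b' + c' - (b + c))"] exI[of _ j]) auto
qed

lemma power_block_1: "(a, b, c, d) \<in> G \<Longrightarrow> power_block G (Suc 0) a b c d"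
  by auto

lemma power_block_SucI:
  assumes "(a1, b1, c1, d1) \<in> G" "power_block G t a b c d"
  shows "power_block G (Suc t) (a1 + a) (b1 + b) (c1 + c) (d1 + d)"
  using assms unfolding power_block.simps
  by (intro exI[of _ a1] exI[of _ b1] exI[of _ c1] exI[of _ d1]) simp

declare power_block.simps(2) [simp del]

lemma power_block_add:
  assumes "power_block G (Suc 0) a b c d" "power_block G t a' b' c' d'"
  shows "power_block G (Suc t) (a + a') (b + b') (c + c') (d + d')"
proof -
  obtain a1 b1 c1 d1 where "(a1, b1, c1, d1) \<in> G" "a1 \<le> a" "b1 \<le> b" "c1 \<le> c" "d1 \<le> d"
    using assms(1) by (auto simp: power_block.simps)
  then show ?thesis
    by - (rule upclosedD[OF upclosed_power_block power_block_SucI[OF _ assms(2), of a1 b1 c1 d1]], simp_all)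
qed

text \<open>Variable 0 is the \<open>x\<close> of all blocks at once, and block \<open>k\<close> owns the variables \<open>3k+1\<close>, \<open>3k+2\<close>, \<open>3k+3\<close> as its \<open>y\<close>,
  \<open>z\<close>, \<open>w\<close>. The additional factor \<open>x^t\<close> keeps the ideal proper when there are no blocks.\<close>

definition total :: "nat \<Rightarrow> (nat \<Rightarrow> region) \<Rightarrow> nat \<Rightarrow> (nat \<Rightarrow>\<^sub>0 nat) set" where
  "total N C t = {m. \<exists>e. t + (\<Sum>k<N. e k) \<le> Poly_Mapping.lookup m 0 \<and>
     (\<forall>k<N. C k (e k) (Poly_Mapping.lookup m (3*k+1)) (Poly_Mapping.lookup m (3*k+2)) (Poly_Mapping.lookup m (3*k+3)))}"

section \<open>Monomials of the product ideal and of its powers\<close>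

lemma var_cases:
  fixes v N :: nat
  assumes "v < 3 * N + 1"
  obtains "v = 0" | k where "k < N" "v = 3*k+1" | k where "k < N" "v = 3*k+2" | k where "k < N" "v = 3*k+3"
proof -
  define k where "k = (v - 1) div 3"
  have "v = 0 \<or> k < N \<and> (v = 3*k+1 \<or> v = 3*k+2 \<or> v = 3*k+3)"
    using assms unfolding k_def by presburger
  then show ?thesis using that by blast
qed

lemma monomial_exists:
  fixes b c d :: "nat \<Rightarrow> nat"
  obtains m :: "nat \<Rightarrow>\<^sub>0 nat" where "Poly_Mapping.keys m \<subseteq> {..<3*N+1}" "Poly_Mapping.lookup m 0 = a"
    "\<forall>k<N. Poly_Mapping.lookup m (3*k+1) = b k \<and> Poly_Mapping.lookup m (3*k+2) = c k \<and>
      Poly_Mapping.lookup m (3*k+3) = d k"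
proof -
  define g where "g v = (let k = (v - 1) div 3 in if v = 0 then a else if v \<ge> 3*N+1 then 0
     else if v = 3*k+1 then b k else if v = 3*k+2 then c k else d k)" for v
  have "finite {v. g v \<noteq> 0}"
    by (rule finite_subset[of _ "{..<3*N+1}"]) (auto simp: g_def Let_def split: if_splits)
  then have l: "Poly_Mapping.lookup (Abs_poly_mapping g) = g" by simp
  show ?thesis
  proof (rule that[of "Abs_poly_mapping g"])
    show "Poly_Mapping.keys (Abs_poly_mapping g) \<subseteq> {..<3*N+1}"
      by (auto simp: in_keys_iff l) (auto simp: g_def Let_def split: if_splits)
    show "Poly_Mapping.lookup (Abs_poly_mapping g) 0 = a" by (simp add: l g_def)
    have "g (3*k+1) = b k \<and> g (3*k+2) = c k \<and> g (3*k+3) = d k" if k: "k < N" for k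
    proof -
      have "(3*k+1-1) div 3 = k" "(3*k+2-1) div 3 = k" "(3*k+3-1) div 3 = k" by presburger+
      then show ?thesis
        using k unfolding g_def Let_def by (simp_all only: if_False if_True; simp)
    qed
    then show "\<forall>k<N. Poly_Mapping.lookup (Abs_poly_mapping g) (3*k+1) = b k \<and>
      Poly_Mapping.lookup (Abs_poly_mapping g) (3*k+2) = c k \<and> Poly_Mapping.lookup (Abs_poly_mapping g) (3*k+3) = d k"
      unfolding l by blast
  qed
qed

lemma monomial_eqI:
  fixes m m' :: "nat \<Rightarrow>\<^sub>0 nat"
  assumes "Poly_Mapping.keys m \<subseteq> {..<3*N+1}" "Poly_Mapping.keys m' \<subseteq> {..<3*N+1}"
    "Poly_Mapping.lookup m 0 = Poly_Mapping.lookup m' 0"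
    "\<And>k. k < N \<Longrightarrow> Poly_Mapping.lookup m (3*k+1) = Poly_Mapping.lookup m' (3*k+1)"
    "\<And>k. k < N \<Longrightarrow> Poly_Mapping.lookup m (3*k+2) = Poly_Mapping.lookup m' (3*k+2)"
    "\<And>k. k < N \<Longrightarrow> Poly_Mapping.lookup m (3*k+3) = Poly_Mapping.lookup m' (3*k+3)"
  shows "m = m'"
proof (rule poly_mapping_eqI)
  fix v
  show "Poly_Mapping.lookup m v = Poly_Mapping.lookup m' v"
  proof (cases "v < 3*N+1")
    case True
    then show ?thesis by (rule var_cases) (use assms in auto)
  next
    case False
    then have "v \<notin> Poly_Mapping.keys m" "v \<notin> Poly_Mapping.keys m'" using assms(1,2) by auto
    then show ?thesis by (simp add: in_keys_iff)
  qed
qed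

lemma totalI:
  assumes "t + (\<Sum>k<N. e k) \<le> Poly_Mapping.lookup m 0"
    "\<And>k. k < N \<Longrightarrow> C k (e k) (Poly_Mapping.lookup m (3*k+1)) (Poly_Mapping.lookup m (3*k+2)) (Poly_Mapping.lookup m (3*k+3))"
  shows "m \<in> total N C t"
  unfolding total_def mem_Collect_eq by (rule exI[of _ e]) (intro conjI allI impI assms)

lemma totalE:
  assumes "m \<in> total N C t"
  obtains e where "t + (\<Sum>k<N. e k) \<le> Poly_Mapping.lookup m 0"
    "\<forall>k<N. C k (e k) (Poly_Mapping.lookup m (3*k+1)) (Poly_Mapping.lookup m (3*k+2)) (Poly_Mapping.lookup m (3*k+3))"
proof -
  from assms obtain e where "t + (\<Sum>k<N. e k) \<le> Poly_Mapping.lookup m 0 \<and>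
     (\<forall>k<N. C k (e k) (Poly_Mapping.lookup m (3*k+1)) (Poly_Mapping.lookup m (3*k+2)) (Poly_Mapping.lookup m (3*k+3)))"
    unfolding total_def mem_Collect_eq ..
  then show ?thesis by (intro that[of e]) simp_all
qed

lemma total_add:
  assumes up: "\<And>k. k < N \<Longrightarrow> upclosed (C k)" and m: "m \<in> total N C t"
  shows "m + m' \<in> total N C t"
  using m
proof (rule totalE)
  fix e assume e: "t + (\<Sum>k<N. e k) \<le> Poly_Mapping.lookup m 0"
    "\<forall>k<N. C k (e k) (Poly_Mapping.lookup m (3*k+1)) (Poly_Mapping.lookup m (3*k+2)) (Poly_Mapping.lookup m (3*k+3))"
  show ?thesis
  proof (rule totalI[where e = e])
    fix k assume k: "k < N"
    show "C k (e k) (Poly_Mapping.lookup (m + m') (3*k+1)) (Poly_Mapping.lookup (m + m') (3*k+2)) (Poly_Mapping.lookup (m + m') (3*k+3))"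
      by (rule upclosedD[OF up[OF k] e(2)[rule_format, OF k]]) (simp_all add: lookup_add)
  qed (use e(1) in \<open>simp add: lookup_add\<close>)
qed

locale block_product =
  fixes N :: nat and G :: "nat \<Rightarrow> (nat \<times> nat \<times> nat \<times> nat) set"
begin

abbreviation "U t \<equiv> total N (\<lambda>k. power_block (G k) t) t"

lemma U_up: "m \<in> U t \<Longrightarrow> m + m' \<in> U t"
  by (rule total_add[OF upclosed_power_block])

text \<open>Once the exponent of \<open>x\<close> is distributed by \<open>e\<close>, the blocks
  split independently: one generator is taken from each.\<close>

lemma U_split:
  assumes "m \<in> U (Suc t)" "Poly_Mapping.keys m \<subseteq> {..<3*N+1}"
  shows "\<exists>m1\<in>U (Suc 0). \<exists>m2\<in>U t. m = m1 + m2"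
proof -
  let ?l = "Poly_Mapping.lookup"
  from assms(1) obtain e where e: "Suc t + (\<Sum>k<N. e k) \<le> ?l m 0"
    "\<forall>k<N. power_block (G k) (Suc t) (e k) (?l m (3*k+1)) (?l m (3*k+2)) (?l m (3*k+3))"
    by (rule totalE)
  define good where "good k g \<longleftrightarrow> (case g of (a, b, c, d) \<Rightarrow> (a, b, c, d) \<in> G k \<and> a \<le> e k \<and>
      b \<le> ?l m (3*k+1) \<and> c \<le> ?l m (3*k+2) \<and> d \<le> ?l m (3*k+3) \<and>
      power_block (G k) t (e k - a) (?l m (3*k+1) - b) (?l m (3*k+2) - c) (?l m (3*k+3) - d))" for k g
  have "\<forall>k. \<exists>g. k < N \<longrightarrow> good k g"
    using e(2)[rule_format] by (auto simp: good_def power_block.simps)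
  then obtain g where "\<forall>k. k < N \<longrightarrow> good k (g k)"
    by (rule choice[THEN exE])
  then have g: "good k (g k)" if "k < N" for k using that by blast
  define a b c d where "a k = fst (g k)" and "b k = fst (snd (g k))"
    and "c k = fst (snd (snd (g k)))" and "d k = snd (snd (snd (g k)))" for k
  have g: "(a k, b k, c k, d k) \<in> G k" "a k \<le> e k" "b k \<le> ?l m (3*k+1)" "c k \<le> ?l m (3*k+2)" "d k \<le> ?l m (3*k+3)"
      "power_block (G k) t (e k - a k) (?l m (3*k+1) - b k) (?l m (3*k+2) - c k) (?l m (3*k+3) - d k)"
    if "k < N" for k
    using g[OF that] by (auto simp: good_def a_def b_def c_def d_def split: prod.splits)
  \<comment> \<open>The summand 1 is the extra factor \<open>x\<close> of the product ideal; every
    surplus exponent stays in \<open>m - m1\<close>.\<close>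
  obtain m1 where m1': "Poly_Mapping.keys m1 \<subseteq> {..<3*N+1}" "?l m1 0 = 1 + (\<Sum>k<N. a k)"
    "\<forall>k<N. ?l m1 (3*k+1) = b k \<and> ?l m1 (3*k+2) = c k \<and> ?l m1 (3*k+3) = d k"
    by (rule monomial_exists[of N "1 + (\<Sum>k<N. a k)" b c d])
  note m1 = m1'(1,2) m1'(3)[rule_format, THEN conjunct1] m1'(3)[rule_format, THEN conjunct2, THEN conjunct1]
    m1'(3)[rule_format, THEN conjunct2, THEN conjunct2]
  have sum_le: "(\<Sum>k<N. a k) \<le> (\<Sum>k<N. e k)" using g(2) by (intro sum_mono) auto
  have km: "Poly_Mapping.keys (m - m1) \<subseteq> {..<3*N+1}"
  proof (rule order.trans[OF _ assms(2)])
    show "Poly_Mapping.keys (m - m1) \<subseteq> Poly_Mapping.keys m"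
      by (auto simp: in_keys_iff lookup_minus)
  qed
  have "m = m1 + (m - m1)"
    by (rule monomial_eqI[of _ N])
      (use assms(2) m1 km e(1) sum_le g in \<open>auto simp: keys_add_nat lookup_add lookup_minus\<close>)
  moreover have "m1 \<in> U (Suc 0)"
    by (rule totalI[where e = a]) (simp add: m1(2), simp only: m1(3-5) g(1) power_block_1)
  moreover have "m - m1 \<in> U t"
  proof -
    have "t + (\<Sum>k<N. e k - a k) \<le> ?l (m - m1) 0"
    proof -
      have "(\<Sum>k<N. e k - a k) = (\<Sum>k<N. e k) - (\<Sum>k<N. a k)"
        by (rule sum_subtractf_nat) (use g(2) in simp)
      then show ?thesis using e(1) sum_le by (simp add: lookup_minus m1(2))
    qed
    then show ?thesis
      by (rule totalI[where e = "\<lambda>k. e k - a k"]) (simp only: lookup_minus m1(3-5) g(6))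
  qed
  ultimately show ?thesis by blast
qed

lemma U_add:
  assumes "m \<in> U (Suc 0)" "m' \<in> U t"
  shows "m + m' \<in> U (Suc t)"
proof -
  let ?l = "Poly_Mapping.lookup"
  from assms(1) obtain e where e: "Suc 0 + (\<Sum>k<N. e k) \<le> ?l m 0"
    "\<forall>k<N. power_block (G k) (Suc 0) (e k) (?l m (3*k+1)) (?l m (3*k+2)) (?l m (3*k+3))"
    by (rule totalE)
  from assms(2) obtain e' where e': "t + (\<Sum>k<N. e' k) \<le> ?l m' 0"
    "\<forall>k<N. power_block (G k) t (e' k) (?l m' (3*k+1)) (?l m' (3*k+2)) (?l m' (3*k+3))"
    by (rule totalE)
  show ?thesis
  proof (rule totalI[where e = "\<lambda>k. e k + e' k"])
    fix k assume "k < N"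
    then show "power_block (G k) (Suc t) (e k + e' k) (?l (m + m') (3*k+1)) (?l (m + m') (3*k+2)) (?l (m + m') (3*k+3))"
      unfolding lookup_add by (intro power_block_add e(2)[rule_format] e'(2)[rule_format])
  qed (use e(1) e'(1) in \<open>simp add: lookup_add sum.distrib\<close>)
qed

lemma ideal_pow_U: "ideal_pow (3*N+1) (mon_span (3*N+1) (U (Suc 0)) :: 'k::field mpoly set) t = mon_span (3*N+1) (U t)"
proof (rule ideal_pow_mon_span)
  have "m \<in> U 0" for m
    by (rule totalI[where e = "\<lambda>_. 0"]) simp_all
  then show "U 0 = UNIV" by blast
qed (fact U_up U_add U_split)+

section \<open>Identifying \<open>z\<close> with \<open>y\<close> in selected blocks\<close>

definition \<tau> :: "nat set \<Rightarrow> nat \<Rightarrow> nat" where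
  "\<tau> K v = (if \<exists>k\<in>K. v = 3*k+2 then v - 1 else v)"

definition glued :: "nat set \<Rightarrow> nat \<Rightarrow> nat \<Rightarrow> region" where
  "glued K t k = (if k \<in> K then glue (power_block (G k) t) else power_block (G k) t)"

lemma upclosed_glued: "upclosed (glued K t k)"
  by (simp add: glued_def upclosed_glue upclosed_power_block)

lemma lookup_push_\<tau>:
  "Poly_Mapping.lookup (push (\<tau> K) m) 0 = Poly_Mapping.lookup m 0"
  "Poly_Mapping.lookup (push (\<tau> K) m) (3*k+1) =
     Poly_Mapping.lookup m (3*k+1) + (if k \<in> K then Poly_Mapping.lookup m (3*k+2) else (0::nat))"
  "Poly_Mapping.lookup (push (\<tau> K) m) (3*k+2) = (if k \<in> K then 0 else Poly_Mapping.lookup m (3*k+2))"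
  "Poly_Mapping.lookup (push (\<tau> K) m) (3*k+3) = Poly_Mapping.lookup m (3*k+3)"
proof -
  have "{a. \<tau> K a = 0} = {0}" by (auto simp: \<tau>_def)
  then show "Poly_Mapping.lookup (push (\<tau> K) m) 0 = Poly_Mapping.lookup m 0"
    by (subst lookup_push) auto
  have "{a. \<tau> K a = 3*k+1} = (if k \<in> K then {3*k+1, 3*k+2} else {3*k+1})"
    unfolding \<tau>_def by (auto; presburger)
  then show "Poly_Mapping.lookup (push (\<tau> K) m) (3*k+1) =
     Poly_Mapping.lookup m (3*k+1) + (if k \<in> K then Poly_Mapping.lookup m (3*k+2) else 0)"
    by (subst lookup_push) auto
  have "{a. \<tau> K a = 3*k+2} = (if k \<in> K then {} else {3*k+2})"
    unfolding \<tau>_def by (auto; presburger)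
  then show "Poly_Mapping.lookup (push (\<tau> K) m) (3*k+2) = (if k \<in> K then 0 else Poly_Mapping.lookup m (3*k+2))"
    by (subst lookup_push) auto
  have "{a. \<tau> K a = 3*k+3} = {3*k+3}"
    unfolding \<tau>_def by (auto; presburger)
  then show "Poly_Mapping.lookup (push (\<tau> K) m) (3*k+3) = Poly_Mapping.lookup m (3*k+3)"
    by (subst lookup_push) auto
qed

lemma ideal_gen_glued:
  fixes t :: nat
  assumes K: "K \<subseteq> {..<N}"
  shows "ideal_gen (3*N+1) (mon_span (3*N+1) (U t) \<union> (\<lambda>k. var (3*k+2) - var (3*k+1)) ` K)
     = {p \<in> polyring (3*N+1). Poly_Mapping.keys (push (push (\<tau> K)) p :: 'k::field mpoly) \<subseteq> total N (glued K t) t}"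
proof -
  let ?l = "Poly_Mapping.lookup"
  let ?V = "(\<lambda>k. 3*k+2) ` K"
  have \<tau>n: "\<tau> K v < 3*N+1" if "v < 3*N+1" for v using that by (auto simp: \<tau>_def)
  have "(\<lambda>v. var v - var (\<tau> K v)) ` ?V = (\<lambda>k. var (3*k+2) - var (3*k+1) :: 'k mpoly) ` K"
    unfolding image_image by (rule image_cong) (auto simp: \<tau>_def)
  moreover have "ideal_gen (3*N+1) (mon_span (3*N+1) (U t) \<union> (\<lambda>v. var v - var (\<tau> K v)) ` ?V)
     = {p \<in> polyring (3*N+1). Poly_Mapping.keys (push (push (\<tau> K)) p :: 'k mpoly) \<subseteq> total N (glued K t) t}"
  proof (rule ideal_gen_glue)
    show "\<tau> K (\<tau> K v) = \<tau> K v" for v by (auto simp: \<tau>_def) presburger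
    show "\<tau> K v < 3*N+1" if "v < 3*N+1" for v by (rule \<tau>n[OF that])
    show "?V \<subseteq> {..<3*N+1}" using K by auto
    show "\<tau> K v = v" if "v \<notin> ?V" for v using that by (auto simp: \<tau>_def)
    show "U t \<subseteq> total N (glued K t) t"
    proof
      fix m assume "m \<in> U t"
      then obtain e where e: "t + (\<Sum>k<N. e k) \<le> ?l m 0"
        "\<forall>k<N. power_block (G k) t (e k) (?l m (3*k+1)) (?l m (3*k+2)) (?l m (3*k+3))"
        by (rule totalE)
      then show "m \<in> total N (glued K t) t"
        by (intro totalI[where e = e]) (auto simp: glued_def glue_def)
    qed
    show "m + m' \<in> total N (glued K t) t" if "m \<in> total N (glued K t) t" for m m'
      by (rule total_add[OF upclosed_glued that])
    have "glued K t k e (?l (push (\<tau> K) m) (3*k+1)) (?l (push (\<tau> K) m) (3*k+2)) (?l (push (\<tau> K) m) (3*k+3))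
      = glued K t k e (?l m (3*k+1)) (?l m (3*k+2)) (?l m (3*k+3))" for k e m
      unfolding lookup_push_\<tau> by (simp add: glued_def glue_def)
    then show "push (\<tau> K) m \<in> total N (glued K t) t \<longleftrightarrow> m \<in> total N (glued K t) t" for m
      unfolding total_def mem_Collect_eq by (simp only: lookup_push_\<tau>(1))
    fix m assume m: "m \<in> total N (glued K t) t" "Poly_Mapping.keys m \<subseteq> {..<3*N+1}"
    from m(1) obtain e where e: "t + (\<Sum>k<N. e k) \<le> ?l m 0"
      "\<forall>k<N. glued K t k (e k) (?l m (3*k+1)) (?l m (3*k+2)) (?l m (3*k+3))"
      by (rule totalE)
    \<comment> \<open>A pair holds new exponents of \<open>y\<close> and \<open>z\<close>. Glued
      blocks may redistribute them; elsewhere the first entry is fixed, and the prescribed sum then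
      fixes the second.\<close>
    define good where "good k p \<longleftrightarrow> fst p + snd p = ?l m (3*k+1) + ?l m (3*k+2) \<and>
        (k \<notin> K \<longrightarrow> fst p = ?l m (3*k+1)) \<and> power_block (G k) t (e k) (fst p) (snd p) (?l m (3*k+3))" for k p
    have "\<exists>p. k < N \<longrightarrow> good k p" for k
      using e(2)[rule_format, of k] by (cases "k \<in> K") (auto simp: glued_def glue_def good_def)
    then have "\<forall>k. \<exists>p. k < N \<longrightarrow> good k p" ..
    then obtain p where p: "\<forall>k. k < N \<longrightarrow> good k (p k)"
      by (rule choice[THEN exE])
    define i j where "i k = fst (p k)" and "j k = snd (p k)" for k
    have ij: "i k + j k = ?l m (3*k+1) + ?l m (3*k+2)" "k \<notin> K \<Longrightarrow> i k = ?l m (3*k+1)"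
      "power_block (G k) t (e k) (i k) (j k) (?l m (3*k+3))" if "k < N" for k
      using p that by (auto simp: good_def i_def j_def)
    obtain u where u': "Poly_Mapping.keys u \<subseteq> {..<3*N+1}" "?l u 0 = ?l m 0"
      "\<forall>k<N. ?l u (3*k+1) = i k \<and> ?l u (3*k+2) = j k \<and> ?l u (3*k+3) = ?l m (3*k+3)"
      by (rule monomial_exists[of N "?l m 0" i j "\<lambda>k. ?l m (3*k+3)"])
    note u = u'(1,2) u'(3)[rule_format, THEN conjunct1] u'(3)[rule_format, THEN conjunct2, THEN conjunct1]
      u'(3)[rule_format, THEN conjunct2, THEN conjunct2]
    have "u \<in> U t"
      by (rule totalI[where e = e]) (use e(1) in \<open>simp add: u(2)\<close>, simp only: u(3-5) ij(3))
    moreover have "push (\<tau> K) u = push (\<tau> K) m"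
    proof (rule monomial_eqI[of _ N])
      show "Poly_Mapping.keys (push (\<tau> K) u) \<subseteq> {..<3*N+1}" "Poly_Mapping.keys (push (\<tau> K) m) \<subseteq> {..<3*N+1}"
        by (rule keys_push_subset; use u(1) m(2) \<tau>n in blast)+
      fix k assume "k < N"
      then show "?l (push (\<tau> K) u) (3*k+1) = ?l (push (\<tau> K) m) (3*k+1)"
        "?l (push (\<tau> K) u) (3*k+2) = ?l (push (\<tau> K) m) (3*k+2)"
        "?l (push (\<tau> K) u) (3*k+3) = ?l (push (\<tau> K) m) (3*k+3)"
        unfolding lookup_push_\<tau> using u ij(1)[of k] ij(2)[of k] by auto
    qed (simp add: lookup_push_\<tau> u)
    ultimately show "\<exists>u\<in>U t. Poly_Mapping.keys u \<subseteq> {..<3*N+1} \<and> push (\<tau> K) u = push (\<tau> K) m"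
      using u(1) by blast
  qed
  ultimately show ?thesis by simp
qed

lemma monom1_mem_glued:
  assumes "K \<subseteq> {..<N}" "Poly_Mapping.keys m \<subseteq> {..<3*N+1}"
  shows "(monom1 m :: 'k::field mpoly) \<in> ideal_gen (3*N+1) (mon_span (3*N+1) (U t) \<union> (\<lambda>k. var (3*k+2) - var (3*k+1)) ` K)
     \<longleftrightarrow> m \<in> total N (glued K t) t"
proof -
  let ?l = "Poly_Mapping.lookup"
  have "glued K t k e (?l (push (\<tau> K) m) (3*k+1)) (?l (push (\<tau> K) m) (3*k+2)) (?l (push (\<tau> K) m) (3*k+3))
      = glued K t k e (?l m (3*k+1)) (?l m (3*k+2)) (?l m (3*k+3))" for k e
    unfolding lookup_push_\<tau> by (simp add: glued_def glue_def)
  then have "push (\<tau> K) m \<in> total N (glued K t) t \<longleftrightarrow> m \<in> total N (glued K t) t"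
    unfolding total_def mem_Collect_eq by (simp only: lookup_push_\<tau>(1))
  then show ?thesis
    unfolding ideal_gen_glued[OF assms(1)] using single_in_polyring[OF assms(2), of "1 :: 'k"]
    by (simp add: monom1_def)
qed

text \<open>Lifts the exchange property of an unglued block to the product. The memberships of
  \<open>m y\<close> and \<open>m z\<close> may distribute \<open>x\<close> differently; the
  distribution giving more of \<open>x\<close> to block \<open>k\<close> also works for
  \<open>m\<close>.\<close>

lemma total_exchange:
  assumes k: "k < N" "k \<notin> K"
    and W: "\<And>a b c d. power_block (G k) t a (Suc b) c d \<Longrightarrow> power_block (G k) t a b (Suc c) d \<Longrightarrow> power_block (G k) t a b c d"
    and y: "m + Poly_Mapping.single (3*k+1) 1 \<in> total N (glued K t) t"
    and z: "m + Poly_Mapping.single (3*k+2) 1 \<in> total N (glued K t) t"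
  shows "m \<in> total N (glued K t) t"
proof -
  let ?l = "Poly_Mapping.lookup"
  have indices: "(3*j+1 = 3*k+1) = (j = k)" "(3*j+2 = 3*k+2) = (j = k)" "3*j+1 \<noteq> 3*k+2" "3*j+2 \<noteq> 3*k+1"
    "3*j+3 \<noteq> 3*k+1" "3*j+3 \<noteq> 3*k+2" for j :: nat by presburger+
  have y0: "?l (m + Poly_Mapping.single (3*k+1) 1) 0 = ?l m 0"
    "?l (m + Poly_Mapping.single (3*k+1) 1) (3*j+1) = ?l m (3*j+1) + (if j = k then 1 else 0)"
    "?l (m + Poly_Mapping.single (3*k+1) 1) (3*j+2) = ?l m (3*j+2)"
    "?l (m + Poly_Mapping.single (3*k+1) 1) (3*j+3) = ?l m (3*j+3)"
    and z0: "?l (m + Poly_Mapping.single (3*k+2) 1) 0 = ?l m 0"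
    "?l (m + Poly_Mapping.single (3*k+2) 1) (3*j+1) = ?l m (3*j+1)"
    "?l (m + Poly_Mapping.single (3*k+2) 1) (3*j+2) = ?l m (3*j+2) + (if j = k then 1 else 0)"
    "?l (m + Poly_Mapping.single (3*k+2) 1) (3*j+3) = ?l m (3*j+3)" for j
    unfolding lookup_add lookup_single when_def using indices[of j] by auto
  from y obtain e where e: "t + (\<Sum>j<N. e j) \<le> ?l m 0"
    "\<forall>j<N. glued K t j (e j) (?l m (3*j+1) + (if j = k then 1 else 0)) (?l m (3*j+2)) (?l m (3*j+3))"
    by (rule totalE) (simp only: y0)
  from z obtain e' where e': "t + (\<Sum>j<N. e' j) \<le> ?l m 0"
    "\<forall>j<N. glued K t j (e' j) (?l m (3*j+1)) (?l m (3*j+2) + (if j = k then 1 else 0)) (?l m (3*j+3))"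
    by (rule totalE) (simp only: z0)
  \<comment> \<open>At the larger share both hypotheses of \<open>W\<close> hold, since regions are
    upward closed.\<close>
  let ?a = "max (e k) (e' k)"
  have "power_block (G k) t (e k) (?l m (3*k+1) + 1) (?l m (3*k+2)) (?l m (3*k+3))"
    using e(2)[rule_format, OF k(1)] k(2) by (simp add: glued_def)
  then have "power_block (G k) t ?a (Suc (?l m (3*k+1))) (?l m (3*k+2)) (?l m (3*k+3))"
    by (rule upclosedD[OF upclosed_power_block]) simp_all
  moreover have "power_block (G k) t (e' k) (?l m (3*k+1)) (?l m (3*k+2) + 1) (?l m (3*k+3))"
    using e'(2)[rule_format, OF k(1)] k(2) by (simp add: glued_def)
  then have "power_block (G k) t ?a (?l m (3*k+1)) (Suc (?l m (3*k+2))) (?l m (3*k+3))"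
    by (rule upclosedD[OF upclosed_power_block]) simp_all
  ultimately have "glued K t k ?a (?l m (3*k+1)) (?l m (3*k+2)) (?l m (3*k+3))"
    using W k(2) by (simp add: glued_def)
  note W' = this
  show ?thesis
  proof (cases "e' k \<le> e k")
    case True
    show ?thesis
    proof (rule totalI[OF e(1)])
      fix j assume "j < N"
      then show "glued K t j (e j) (?l m (3*j+1)) (?l m (3*j+2)) (?l m (3*j+3))"
        using e(2)[rule_format, of j] W' True by (cases "j = k") simp_all
    qed
  next
    case False
    show ?thesis
    proof (rule totalI[OF e'(1)])
      fix j assume "j < N"
      then show "glued K t j (e' j) (?l m (3*j+1)) (?l m (3*j+2)) (?l m (3*j+3))"
        using e'(2)[rule_format, of j] W' False by (cases "j = k") simp_all
    qed
  qed
qed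

text \<open>If the socle monomials of the blocks have \<open>x\<close>-exponents \<open>a k\<close>, a monomial of the product ideal with the same
  exponents elsewhere needs at least \<open>a k + 1\<close> factors \<open>x\<close> for every block; one less than this total is a socle monomial.\<close>

lemma total_socle:
  assumes t: "t \<ge> 1" and socle: "\<And>k. k < N \<Longrightarrow> \<exists>a b c d. socle_point (glued K t k) a b c d"
  obtains u where "Poly_Mapping.keys u \<subseteq> {..<3*N+1}" "u \<notin> total N (glued K t) t"
    "\<And>v. v < 3*N+1 \<Longrightarrow> Poly_Mapping.single v 1 + u \<in> total N (glued K t) t"
proof -
  let ?l = "Poly_Mapping.lookup"
  define good where "good k p \<longleftrightarrow> (case p of (a, b, c, d) \<Rightarrow> socle_point (glued K t k) a b c d)" for k p
  have "\<exists>p. k < N \<longrightarrow> good k p" for k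
  proof (cases "k < N")
    case True
    from socle[OF True] obtain a b c d where "socle_point (glued K t k) a b c d" by (elim exE)
    then show ?thesis by (intro exI[of _ "(a, b, c, d)"]) (simp add: good_def)
  qed simp
  then have "\<forall>k. \<exists>p. k < N \<longrightarrow> good k p" ..
  then obtain p where p: "\<forall>k. k < N \<longrightarrow> good k (p k)"
    by (rule choice[THEN exE])
  define a b c d where "a k = fst (p k)" and "b k = fst (snd (p k))"
    and "c k = fst (snd (snd (p k)))" and "d k = snd (snd (snd (p k)))" for k
  have s: "socle_point (glued K t k) (a k) (b k) (c k) (d k)" if "k < N" for k
    using p that by (auto simp: good_def a_def b_def c_def d_def split: prod.splits)
  \<comment> \<open>The subtraction is not truncated because \<open>t \<ge> 1\<close>.\<close>
  obtain u where u': "Poly_Mapping.keys u \<subseteq> {..<3*N+1}" "?l u 0 = t + (\<Sum>k<N. Suc (a k)) - 1"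
    "\<forall>k<N. ?l u (3*k+1) = b k \<and> ?l u (3*k+2) = c k \<and> ?l u (3*k+3) = d k"
    by (rule monomial_exists[of N "t + (\<Sum>k<N. Suc (a k)) - 1" b c d])
  note u = u'(1,2) u'(3)[rule_format, THEN conjunct1] u'(3)[rule_format, THEN conjunct2, THEN conjunct1]
    u'(3)[rule_format, THEN conjunct2, THEN conjunct2]
  have "u \<notin> total N (glued K t) t"
  proof
    assume "u \<in> total N (glued K t) t"
    then obtain e where e: "t + (\<Sum>k<N. e k) \<le> ?l u 0"
      "\<forall>k<N. glued K t k (e k) (?l u (3*k+1)) (?l u (3*k+2)) (?l u (3*k+3))"
      by (rule totalE)
    have "Suc (a k) \<le> e k" if "k < N" for k
    proof (rule ccontr)
      assume "\<not> Suc (a k) \<le> e k"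
      moreover have "glued K t k (e k) (b k) (c k) (d k)"
        using e(2)[rule_format, OF that] by (simp only: u(3-5)[OF that])
      ultimately have "glued K t k (a k) (b k) (c k) (d k)"
        using upclosedD[OF upclosed_glued, of K t k "e k" "b k" "c k" "d k" "a k" "b k" "c k" "d k"] by simp
      then show False using s[OF that] by (simp add: socle_point_def)
    qed
    then have "(\<Sum>k<N. Suc (a k)) \<le> (\<Sum>k<N. e k)" by (intro sum_mono) auto
    then show False using e(1) u(2) t by linarith
  qed
  have lv: "?l (Poly_Mapping.single v 1 + u) (3*k+1) = b k + (if v = 3*k+1 then 1 else 0)"
    "?l (Poly_Mapping.single v 1 + u) (3*k+2) = c k + (if v = 3*k+2 then 1 else 0)"
    "?l (Poly_Mapping.single v 1 + u) (3*k+3) = d k + (if v = 3*k+3 then 1 else 0)" if "k < N" for k v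
    unfolding lookup_add lookup_single when_def u(3-5)[OF that] by simp_all
  have "Poly_Mapping.single 0 1 + u \<in> total N (glued K t) t"
  proof (rule totalI[where e = "\<lambda>k. Suc (a k)"])
    fix k assume k: "k < N"
    show "glued K t k (Suc (a k)) (?l (Poly_Mapping.single 0 1 + u) (3*k+1)) (?l (Poly_Mapping.single 0 1 + u) (3*k+2))
        (?l (Poly_Mapping.single 0 1 + u) (3*k+3))"
      unfolding lv[OF k] using s[OF k] by (simp add: socle_point_def)
  qed (use t in \<open>simp add: lookup_add u(2)\<close>)
  moreover have "Poly_Mapping.single v 1 + u \<in> total N (glued K t) t"
    if k: "k < N" and v: "v = 3*k+1 \<or> v = 3*k+2 \<or> v = 3*k+3" for k v
  proof -
    \<comment> \<open>Multiplication by a variable of block \<open>k\<close> brings that block into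
      its region already at \<open>a k\<close>, which saves the one missing factor
      \<open>x\<close>.\<close>
    define e where "e = (\<lambda>j. if j = k then a j else Suc (a j))"
    show ?thesis
    proof (rule totalI[where e = e])
      have "(\<Sum>j<N. Suc (a j)) = Suc (\<Sum>j<N. e j)"
        using k by (simp add: e_def sum.remove[of _ k])
      then show "t + (\<Sum>j<N. e j) \<le> ?l (Poly_Mapping.single v 1 + u) 0"
        using u(2) v by (auto simp: lookup_add)
      fix j assume j: "j < N"
      show "glued K t j (e j) (?l (Poly_Mapping.single v 1 + u) (3*j+1)) (?l (Poly_Mapping.single v 1 + u) (3*j+2))
        (?l (Poly_Mapping.single v 1 + u) (3*j+3))"
        unfolding lv[OF j]
      proof (cases "j = k")
        case True
        then show "glued K t j (e j) (b j + (if v = 3*j+1 then 1 else 0)) (c j + (if v = 3*j+2 then 1 else 0))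
          (d j + (if v = 3*j+3 then 1 else 0))"
          using s[OF j] v by (auto simp: socle_point_def e_def)
      next
        case False
        then have "v \<noteq> 3*j+1" "v \<noteq> 3*j+2" "v \<noteq> 3*j+3" using v by presburger+
        then show "glued K t j (e j) (b j + (if v = 3*j+1 then 1 else 0)) (c j + (if v = 3*j+2 then 1 else 0))
          (d j + (if v = 3*j+3 then 1 else 0))"
          using s[OF j] False by (simp add: socle_point_def e_def)
      qed
    qed
  qed
  ultimately have "Poly_Mapping.single v 1 + u \<in> total N (glued K t) t" if "v < 3*N+1" for v
    using var_cases[OF that] by metis
  with u(1) \<open>u \<notin> total N (glued K t) t\<close> show ?thesis by (rule that)
qed

text \<open>The differences \<open>\<theta> k\<close> of the blocks of depth 1 form a regular
  sequence, because each block still has its exchange property when its turn comes. After gluing all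
  of them every block has a socle point, hence so does the product.\<close>

lemma depth_product:
  fixes w :: "nat \<Rightarrow> nat \<Rightarrow> nat"
  assumes t: "t \<ge> 1" and good: "\<And>k. k < N \<Longrightarrow> good_block (G k) (w k)"
  shows "depth_quot (3*N+1) (ideal_pow (3*N+1) (mon_span (3*N+1) (U (Suc 0)) :: 'k::field mpoly set) t) = enat (\<Sum>k<N. w k t)"
proof -
  let ?n = "3*N+1"
  define I :: "'k mpoly set" where "I = mon_span ?n (U t)"
  define \<theta> :: "nat \<Rightarrow> 'k mpoly" where "\<theta> k = var (3*k+2) - var (3*k+1)" for k
  define ks where "ks = filter (\<lambda>k. w k t = 1) [0..<N]"
  have block: "w k t = 0 \<and> (\<exists>a b c d. socle_point (power_block (G k) t) a b c d) \<or>
     w k t = 1 \<and> (\<forall>a b c d. power_block (G k) t a (Suc b) c d \<longrightarrow> power_block (G k) t a b (Suc c) d \<longrightarrow> power_block (G k) t a b c d)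
       \<and> (\<exists>a b c d. socle_point (glue (power_block (G k) t)) a b c d)" if "k < N" for k
    using good[OF that] t unfolding good_block_def by blast
  have length_ks: "length ks = (\<Sum>k<N. w k t)"
  proof -
    have "length (filter (\<lambda>k. w k t = 1) [0..<M]) = (\<Sum>k<M. w k t)" if "M \<le> N" for M
      using that
    proof (induction M)
      case (Suc M)
      then show ?case using block[of M] by auto
    qed simp
    then show ?thesis by (simp add: ks_def)
  qed
  have I: "polyring.ideal_in ?n I" unfolding I_def by (rule ideal_in_mon_span) (rule U_up)
  have ks: "set ks = {k. k < N \<and> w k t = 1}" "distinct ks" by (auto simp: ks_def)
  let ?K = "set ks"
  have KN: "?K \<subseteq> {..<N}" using ks(1) by auto
  have "\<exists>a b c d. socle_point (glued ?K t k) a b c d" if "k < N" for k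
    using block[OF that] that by (auto simp: glued_def ks(1))
  then obtain u where u: "Poly_Mapping.keys u \<subseteq> {..<?n}" "u \<notin> total N (glued ?K t) t"
    "\<And>v. v < ?n \<Longrightarrow> Poly_Mapping.single v 1 + u \<in> total N (glued ?K t) t"
    using total_socle[OF t, of ?K] by metis
  have mem: "(monom1 m :: 'k mpoly) \<in> ideal_gen ?n (I \<union> \<theta> ` ?K) \<longleftrightarrow> m \<in> total N (glued ?K t) t"
    if "Poly_Mapping.keys m \<subseteq> {..<?n}" for m
    using monom1_mem_glued[OF KN that, of t] by (simp add: I_def \<theta>_def[abs_def])
  have u_in: "(monom1 u :: 'k mpoly) \<in> polyring ?n" using u(1) by (simp add: monom1_def single_in_polyring)
  have u_notin: "(monom1 u :: 'k mpoly) \<notin> ideal_gen ?n (I \<union> \<theta> ` ?K)" using mem[OF u(1)] u(2) by simp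
  have "regular_seq ?n I (map \<theta> ks)"
    unfolding regular_seq_def
  proof (intro conjI allI impI ballI)
    show "set (map \<theta> ks) \<subseteq> max_hom_ideal ?n"
    proof -
      have "\<theta> k \<in> max_hom_ideal ?n" if "k < N" for k
      proof -
        have "Poly_Mapping.single v (1::nat) \<noteq> 0" for v :: nat by (metis lookup_single_eq lookup_zero zero_neq_one)
        then have "Poly_Mapping.lookup (\<theta> k) 0 = 0"
          by (simp add: \<theta>_def lookup_minus var_def monom1_def lookup_single)
        moreover have "\<theta> k \<in> polyring ?n"
          unfolding \<theta>_def using that
          by (intro polyring.ideal_in_diff[OF polyring.ideal_in_R] var_in_polyring) auto
        ultimately show ?thesis by (simp add: max_hom_ideal_def)
      qed
      then show ?thesis using KN by auto
    qed
    show "ideal_gen ?n (I \<union> set (map \<theta> ks)) \<noteq> polyring ?n"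
      using u_in u_notin by auto
    fix i p
    assume i: "i < length (map \<theta> ks)" and p: "p \<in> polyring ?n"
      and "map \<theta> ks ! i * p \<in> ideal_gen ?n (I \<union> set (take i (map \<theta> ks)))"
    define k where "k = ks ! i"
    define K where "K = set (take i ks)"
    have kK: "k < N" "w k t = 1" "k \<notin> K" "K \<subseteq> {..<N}"
      using i ks nth_mem[of i ks] set_take_subset[of i ks]
      by (auto simp: k_def K_def in_set_conv_nth nth_eq_iff_index_eq)
    have gen: "ideal_gen ?n (I \<union> set (take i (map \<theta> ks))) =
        {p \<in> polyring ?n. Poly_Mapping.keys (push (push (\<tau> K)) p) \<subseteq> total N (glued K t) t}"
      using ideal_gen_glued[OF kK(4), of t, where ?'k = 'k]
      by (simp add: I_def \<theta>_def[abs_def] K_def take_map)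
    \<comment> \<open>Block \<open>k\<close> is not glued yet, so the homomorphism fixes both
      variables of \<open>\<theta> k\<close> and regularity becomes a question about the image of
      \<open>p\<close>.\<close>
    have "\<tau> K (3*k+1) = 3*k+1" "\<tau> K (3*k+2) = 3*k+2"
      using kK(3) unfolding \<tau>_def by (auto; presburger)+
    then have "push (push (\<tau> K)) (\<theta> k * p) = (var (3*k+2) - var (3*k+1)) * push (push (\<tau> K)) p"
      by (simp only: push_add_distrib \<theta>_def push_diff push_var)
    then have keys: "Poly_Mapping.keys ((var (3*k+2) - var (3*k+1)) * push (push (\<tau> K)) p) \<subseteq> total N (glued K t) t"
      using \<open>map \<theta> ks ! i * p \<in> _\<close> i unfolding gen by (simp add: k_def)
    have "Poly_Mapping.keys (push (push (\<tau> K)) p) \<subseteq> total N (glued K t) t"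
    proof (rule difference_regular[OF _ total_add[OF upclosed_glued] _ keys])
      show "m \<in> total N (glued K t) t" if "m + Poly_Mapping.single (3*k+1) 1 \<in> total N (glued K t) t"
        "m + Poly_Mapping.single (3*k+2) 1 \<in> total N (glued K t) t" for m
        using total_exchange[OF kK(1,3) _ that] block[OF kK(1)] kK(2) by auto
    qed auto
    then show "p \<in> ideal_gen ?n (I \<union> set (take i (map \<theta> ks)))"
      unfolding gen using p by simp
  qed
  then have "depth_quot ?n I = enat (length (map \<theta> ks))"
  proof (rule depth_quot_eqI[OF I])
    show "(monom1 u :: 'k mpoly) \<in> polyring ?n" by (rule u_in)
    show "(monom1 u :: 'k mpoly) \<notin> ideal_gen ?n (I \<union> set (map \<theta> ks))" using u_notin by simp
    fix v assume v: "v < ?n"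
    have "var v * (monom1 u :: 'k mpoly) = monom1 (Poly_Mapping.single v 1 + u)"
      by (simp add: var_def monom1_def mult_single)
    moreover have "Poly_Mapping.keys (Poly_Mapping.single v 1 + u) \<subseteq> {..<?n}"
      using u(1) v by (auto simp: keys_add_nat)
    ultimately show "var v * (monom1 u :: 'k mpoly) \<in> ideal_gen ?n (I \<union> set (map \<theta> ks))"
      using mem u(3)[OF v] by simp
  qed
  then show ?thesis by (simp only: ideal_pow_U length_map length_ks flip: I_def)
qed

end

section \<open>The building blocks\<close>

text \<open>For \<open>t < d\<close> the least exponent of \<open>z\<close> in \<open>I^t\<close>, as a function of the exponent \<open>e\<close> of \<open>y\<close> in total degree
  \<open>(d+2)t\<close>, rises up to \<open>e = d\<close> and drops to 0 at \<open>e = d + 1\<close>; this strict local maximum yields the socle.\<close>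

definition cost :: "nat \<Rightarrow> nat \<Rightarrow> nat" where
  "cost d e = (if e \<le> d then e - 1 else 0)"

text \<open>The generators of the product of \<open>I\<close> with the ideal generated by
  \<open>T\<close>.\<close>

definition block :: "nat \<Rightarrow> (nat \<times> nat \<times> nat) set \<Rightarrow> (nat \<times> nat \<times> nat \<times> nat) set" where
  "block d T = {(d + 2 - e + x, e, cost d e + z, w) | e x z w. e \<le> d + 2 \<and> (x, z, w) \<in> T}"

text \<open>Triples are exponents of \<open>x\<close>, \<open>z\<close> and \<open>w\<close>.\<close>

definition drop_gens :: "nat \<Rightarrow> (nat \<times> nat \<times> nat) set" where
  "drop_gens d = {(0, 0, d + 1), (d - 1, 1, 1), (d, 1, 0)}"

definition const_gens :: "(nat \<times> nat \<times> nat) set" where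
  "const_gens = {(1, 0, 0), (0, 0, 1)}"

text \<open>Exponents of \<open>y\<close> and \<open>z\<close> in products of exactly
  \<open>t\<close> generators of \<open>I\<close>; the exponent of \<open>x\<close> is then
  \<open>(d+2)t - E\<close>.\<close>

primrec rise_sum :: "nat \<Rightarrow> nat \<Rightarrow> nat \<Rightarrow> nat \<Rightarrow> bool" where
  "rise_sum d 0 E C \<longleftrightarrow> E = 0 \<and> C = 0"
| "rise_sum d (Suc t) E C \<longleftrightarrow>
     (\<exists>e E' C'. e \<le> d + 2 \<and> rise_sum d t E' C' \<and> E = E' + e \<and> C = C' + cost d e)"

primrec gens_sum :: "(nat \<times> nat \<times> nat) set \<Rightarrow> nat \<Rightarrow> nat \<Rightarrow> nat \<Rightarrow> nat \<Rightarrow> bool" where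
  "gens_sum T 0 X Z W \<longleftrightarrow> X = 0 \<and> Z = 0 \<and> W = 0"
| "gens_sum T (Suc t) X Z W \<longleftrightarrow>
     (\<exists>x z w X' Z' W'. (x, z, w) \<in> T \<and> gens_sum T t X' Z' W' \<and> X = X' + x \<and> Z = Z' + z \<and> W = W' + w)"

section \<open>Exponents of products of generators\<close>

lemma rise_sum_le: "rise_sum d t E C \<Longrightarrow> E \<le> (d + 2) * t"
proof (induction t arbitrary: E C)
  case (Suc t)
  then obtain e E' C' where "e \<le> d + 2" "rise_sum d t E' C'" "E = E' + e" by auto
  then show ?case using Suc.IH[of E' C'] by simp
qed simp

text \<open>If the sum is at most \<open>d\<close>, so is every summand, and a summand
  \<open>e \<le> d\<close> costs at least \<open>e - 1\<close>.\<close>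

lemma rise_sum_cost_ge: "rise_sum d t E C \<Longrightarrow> E \<le> d \<Longrightarrow> E \<le> C + t"
proof (induction t arbitrary: E C)
  case (Suc t)
  then obtain e E' C' where e: "rise_sum d t E' C'" "E = E' + e" "C = C' + cost d e" by auto
  then have "E' \<le> C' + t" "e \<le> cost d e + 1" using Suc.IH[of E' C'] Suc.prems(2) by (auto simp: cost_def)
  then show ?case using e by simp
qed simp

lemma gens_sum_SucI:
  assumes "(x, z, w) \<in> T" "gens_sum T t X Z W"
  shows "gens_sum T (Suc t) (X + x) (Z + z) (W + w)"
  unfolding gens_sum.simps using assms
  by - (rule exI[of _ x], rule exI[of _ z], rule exI[of _ w], rule exI[of _ X],
      rule exI[of _ Z], rule exI[of _ W], intro conjI refl)

text \<open>Separates the contributions of the two factor ideals; adding \<open>E\<close> on the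
  right avoids truncated subtraction in the exponent of \<open>x\<close>.\<close>

lemma power_block_iff:
  "power_block (block d T) t a b c w \<longleftrightarrow> (\<exists>E C X Z W. rise_sum d t E C \<and> gens_sum T t X Z W \<and>
     (d + 2) * t + X \<le> a + E \<and> E \<le> b \<and> C + Z \<le> c \<and> W \<le> w)"
proof (induction t arbitrary: a b c w)
  case (Suc t)
  show ?case
  proof
    assume "power_block (block d T) (Suc t) a b c w"
    then obtain a1 b1 c1 w1 where "(a1, b1, c1, w1) \<in> block d T" and le: "a1 \<le> a" "b1 \<le> b" "c1 \<le> c" "w1 \<le> w"
      and pb: "power_block (block d T) t (a - a1) (b - b1) (c - c1) (w - w1)"
      by (auto simp: power_block.simps)
    then obtain x z where g: "a1 = d + 2 - b1 + x" "c1 = cost d b1 + z" "b1 \<le> d + 2" "(x, z, w1) \<in> T"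
      by (auto simp: block_def)
    obtain E C X Z W where *: "rise_sum d t E C" "gens_sum T t X Z W" "(d + 2) * t + X \<le> a - a1 + E"
      "E \<le> b - b1" "C + Z \<le> c - c1" "W \<le> w - w1"
      using pb[unfolded Suc.IH] by auto
    have "rise_sum d (Suc t) (E + b1) (C + cost d b1)"
      using *(1) g(3) by auto
    moreover have "gens_sum T (Suc t) (X + x) (Z + z) (W + w1)"
      using g(4) *(2) by (rule gens_sum_SucI)
    moreover have "(d + 2) * Suc t + (X + x) \<le> a + (E + b1)" "E + b1 \<le> b" "C + cost d b1 + (Z + z) \<le> c" "W + w1 \<le> w"
      using * g le by auto
    ultimately show "\<exists>E C X Z W. rise_sum d (Suc t) E C \<and> gens_sum T (Suc t) X Z W \<and>
        (d + 2) * Suc t + X \<le> a + E \<and> E \<le> b \<and> C + Z \<le> c \<and> W \<le> w"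
      by - (rule exI[of _ "E + b1"], rule exI[of _ "C + cost d b1"], rule exI[of _ "X + x"],
        rule exI[of _ "Z + z"], rule exI[of _ "W + w1"], intro conjI)
  next
    assume "\<exists>E C X Z W. rise_sum d (Suc t) E C \<and> gens_sum T (Suc t) X Z W \<and>
        (d + 2) * Suc t + X \<le> a + E \<and> E \<le> b \<and> C + Z \<le> c \<and> W \<le> w"
    then obtain E0 C0 X0 Z0 W0 where 0: "rise_sum d (Suc t) E0 C0" "gens_sum T (Suc t) X0 Z0 W0"
      "(d + 2) * Suc t + X0 \<le> a + E0" "E0 \<le> b" "C0 + Z0 \<le> c" "W0 \<le> w"
      by (elim exE conjE)
    from 0(1) obtain e E C where E: "e \<le> d + 2" "rise_sum d t E C" "E0 = E + e" "C0 = C + cost d e"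
      unfolding rise_sum.simps by (elim exE conjE)
    from 0(2) obtain x z v X Z W where X: "(x, z, v) \<in> T" "gens_sum T t X Z W" "X0 = X + x" "Z0 = Z + z" "W0 = W + v"
      unfolding gens_sum.simps by (elim exE conjE)
    note * = E(1,2) X(1,2) 0(3-6)[unfolded E(3,4) X(3-5)]
    let ?a = "d + 2 - e + x"
    have le: "?a \<le> a" "(d + 2) * t + X \<le> a - ?a + E"
      using *(1,5) rise_sum_le[OF *(2)] by auto
    have "power_block (block d T) t (a - ?a) (b - e) (c - (cost d e + z)) (w - v)"
      unfolding Suc.IH
    proof (rule exI[of _ E], rule exI[of _ C], rule exI[of _ X], rule exI[of _ Z], rule exI[of _ W], intro conjI)
    qed (use * le(2) in auto)
    moreover have "(?a, e, cost d e + z, v) \<in> block d T"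
      using *(1,3) by (auto simp: block_def)
    ultimately show "power_block (block d T) (Suc t) a b c w"
      unfolding power_block.simps using le(1) *(6-8)
      by - (rule exI[of _ ?a], rule exI[of _ e], rule exI[of _ "cost d e + z"], rule exI[of _ v], intro conjI, simp_all)
  qed
qed simp

lemma power_block_blockI:
  assumes "rise_sum d t E C" "gens_sum T t X Z W" "(d + 2) * t + X \<le> a + E" "E \<le> b" "C + Z \<le> c" "W \<le> w"
  shows "power_block (block d T) t a b c w"
  unfolding power_block_iff
  by (rule exI[of _ E], rule exI[of _ C], rule exI[of _ X], rule exI[of _ Z], rule exI[of _ W], intro conjI assms)

text \<open>The summands 0, 1, \<open>d + 1\<close> and \<open>d + 2\<close> cost nothing, so each
  of the \<open>t\<close> summands can independently contribute to \<open>i\<close> and to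
  \<open>r\<close>.\<close>

lemma rise_sum_free: "i \<le> t \<Longrightarrow> r \<le> t \<Longrightarrow> rise_sum d t (i * (d + 1) + r) 0"
proof (induction t arbitrary: i r)
  case (Suc t)
  define e where "e = (if i = Suc t then d + 1 else 0) + (if r = Suc t then 1 else 0)"
  have "rise_sum d t ((if i = Suc t then t else i) * (d + 1) + (if r = Suc t then t else r)) 0"
    using Suc.prems by (intro Suc.IH) auto
  moreover have "i * (d + 1) + r = ((if i = Suc t then t else i) * (d + 1) + (if r = Suc t then t else r)) + e"
    by (simp add: e_def)
  moreover have "e \<le> d + 2" "cost d e = 0" by (auto simp: e_def cost_def)
  ultimately show ?case by (metis add_0 rise_sum.simps(2))
qed simp

text \<open>Division by \<open>d + 1\<close>, with the quotient capped at \<open>t\<close>, leaves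
  at most \<open>t\<close>. Hence for \<open>t \<ge> d\<close> no \<open>z\<close> is needed and
  \<open>I^t\<close> is a power of \<open>(x, y)\<close>.\<close>

lemma rise_sum_all:
  assumes "d \<le> t" "E \<le> (d + 2) * t"
  shows "rise_sum d t E 0"
proof -
  define i where "i = min t (E div (d + 1))"
  have E: "E = E div (d + 1) * (d + 1) + E mod (d + 1)" by (rule div_mult_mod_eq[symmetric])
  have "i * (d + 1) \<le> E" "E - i * (d + 1) \<le> t"
  proof -
    show "i * (d + 1) \<le> E"
      using E mult_le_mono1[of i "E div (d + 1)" "d + 1"] by (auto simp: i_def)
    show "E - i * (d + 1) \<le> t"
    proof (cases "t \<le> E div (d + 1)")
      case True
      then show ?thesis using assms(2) by (simp add: i_def algebra_simps)
    next
      case False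
      then have "E - i * (d + 1) = E mod (d + 1)" using E by (simp add: i_def)
      also have "\<dots> \<le> d" using mod_less_divisor[of "d + 1" E] by simp
      finally show ?thesis using assms(1) by simp
    qed
  qed
  then show ?thesis using rise_sum_free[of i t "E - i * (d + 1)" d] by (simp add: i_def)
qed

text \<open>One summand \<open>E - t + 1\<close> and \<open>t - 1\<close> summands 1 attain the
  bound of \<open>rise_sum_cost_ge\<close>.\<close>

lemma rise_sum_cost:
  assumes "1 \<le> t" "t \<le> E" "E \<le> d"
  shows "rise_sum d t E (E - t)"
proof -
  obtain t' where t: "t = Suc t'" using assms(1) by (cases t) auto
  have "rise_sum d t' t' 0" using rise_sum_free[of 0 t' t' d] by simp
  then show ?thesis unfolding t rise_sum.simps using assms t
    by - (rule exI[of _ "E - t'"], rule exI[of _ t'], rule exI[of _ 0], auto simp: cost_def)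
qed

lemma rise_sum_Suc_d: "1 \<le> t \<Longrightarrow> rise_sum d t (Suc d) 0"
  using rise_sum_free[of 1 t 0 d] by simp

lemma const_gens_sum: "gens_sum const_gens t X Z W \<longleftrightarrow> X + W = t \<and> Z = 0"
proof (induction t arbitrary: X Z W)
  case (Suc t)
  show ?case
  proof
    assume "gens_sum const_gens (Suc t) X Z W"
    then obtain x z w X' Z' W' where "(x, z, w) \<in> const_gens" "gens_sum const_gens t X' Z' W'"
      "X = X' + x" "Z = Z' + z" "W = W' + w"
      unfolding gens_sum.simps by (elim exE conjE)
    then show "X + W = Suc t \<and> Z = 0" unfolding Suc.IH by (auto simp: const_gens_def)
  next
    assume *: "X + W = Suc t \<and> Z = 0"
    have "(1, 0, 0) \<in> const_gens" "(0, 0, 1) \<in> const_gens" by (auto simp: const_gens_def)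
    note step = this[THEN gens_sum_SucI]
    show "gens_sum const_gens (Suc t) X Z W"
    proof (cases X)
      case 0
      then show ?thesis using * step(2)[of t 0 0 t] by (simp add: Suc.IH del: gens_sum.simps)
    next
      case (Suc X')
      then show ?thesis using * step(1)[of t X' 0 W] by (simp add: Suc.IH del: gens_sum.simps)
    qed
  qed
qed auto

text \<open>If the three generators occur \<open>p\<close>, \<open>q\<close> and \<open>r\<close>
  times, then \<open>p = t - Z\<close>, \<open>q = W + (d+1)Z - (d+1)t\<close> and
  \<open>r = X - (d-1)Z\<close>. The inequalities say that these are nonnegative; the equation is
  homogeneity in degree \<open>d + 1\<close>.\<close>

lemma drop_gens_sum:
  assumes "1 \<le> d"
  shows "gens_sum (drop_gens d) t X Z W \<longleftrightarrow>
    X + Z + W = (d + 1) * t \<and> Z \<le> t \<and> (d + 1) * t \<le> W + (d + 1) * Z \<and> (d - 1) * Z \<le> X"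
proof (induction t arbitrary: X Z W)
  case 0
  then show ?case by auto
next
  case (Suc t)
  obtain c where d: "d = Suc c" using assms by (cases d) auto
  show ?case
  proof
    assume "gens_sum (drop_gens d) (Suc t) X Z W"
    then obtain x z w X' Z' W' where *: "(x, z, w) \<in> drop_gens d" "gens_sum (drop_gens d) t X' Z' W'"
      "X = X' + x" "Z = Z' + z" "W = W' + w" unfolding gens_sum.simps by (elim exE conjE)
    then show "X + Z + W = (d + 1) * Suc t \<and> Z \<le> Suc t \<and> (d + 1) * Suc t \<le> W + (d + 1) * Z \<and> (d - 1) * Z \<le> X"
      unfolding Suc.IH by (auto simp: drop_gens_def d algebra_simps)
  next
    assume *: "X + Z + W = (d + 1) * Suc t \<and> Z \<le> Suc t \<and> (d + 1) * Suc t \<le> W + (d + 1) * Z \<and> (d - 1) * Z \<le> X"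
    have step: "gens_sum (drop_gens d) (Suc t) X Z W"
      if "(x, z, w) \<in> drop_gens d" "x \<le> X" "z \<le> Z" "w \<le> W" "gens_sum (drop_gens d) t (X - x) (Z - z) (W - w)" for x z w
      using gens_sum_SucI[OF that(1,5)] that(2-4) by (simp del: gens_sum.simps)
    have mem: "(0, 0, d + 1) \<in> drop_gens d" "(d - 1, 1, 1) \<in> drop_gens d" "(d, 1, 0) \<in> drop_gens d"
      by (simp_all add: drop_gens_def)
    show "gens_sum (drop_gens d) (Suc t) X Z W"
    proof (cases Z)
      case 0
      show ?thesis
        by (rule step[OF mem(1)]) (use * 0 in \<open>auto simp: Suc.IH algebra_simps\<close>)
    next
      case Z: (Suc Z')
      show ?thesis
      \<comment> \<open>Equality means that the middle generator does not occur, so the last one is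
        split off; otherwise the middle one is.\<close>
      proof (cases "W + (d + 1) * Z = (d + 1) * Suc t")
        case True
        have X: "X = d * Z" using * True by (simp add: algebra_simps)
        show ?thesis
          by (rule step[OF mem(3)]) (use * True X in \<open>auto simp: Suc.IH[unfolded d] Z d algebra_simps\<close>)
      next
        case False
        have W: "W > 0"
        proof (rule ccontr)
          assume "\<not> W > 0"
          then have "(d + 1) * Suc t \<le> (d + 1) * Z" using * by simp
          then have "Z = Suc t" using * by (simp del: mult_Suc mult_Suc_right)
          then show False using False \<open>\<not> W > 0\<close> by simp
        qed
        then obtain W' where "W = Suc W'" by (cases W) auto
        then show ?thesis
          by - (rule step[OF mem(2)]; use * False in \<open>auto simp: Suc.IH[unfolded d] Z d algebra_simps\<close>)
      qed
    qed
  qed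
qed

declare gens_sum.simps(2) [simp del] rise_sum.simps(2) [simp del]

section \<open>Socle points and exchange properties of the building blocks\<close>

lemma socle_pointI:
  assumes "\<not> B a b c w" "B (Suc a) b c w" "B a (Suc b) c w" "B a b (Suc c) w" "B a b c (Suc w)"
  shows "\<exists>a b c w. socle_point B a b c w"
  unfolding socle_point_def using assms by (intro exI conjI)

lemma glueI: "B a i j w \<Longrightarrow> i + j = b + c \<Longrightarrow> glue B a b c w"
  unfolding glue_def by blast

lemma good_block_const:
  assumes d: "1 \<le> d"
  shows "good_block (block d const_gens) (\<lambda>t. if d \<le> t then 1 else 0)"
  unfolding good_block_def
proof (intro allI impI)
  fix t :: nat assume t: "1 \<le> t"
  let ?B = "power_block (block d const_gens) t"
  note I = power_block_blockI[of d t _ _ const_gens]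
  show "(if d \<le> t then 1 else 0) = (0::nat) \<and> (\<exists>a b c w. socle_point ?B a b c w) \<or>
     (if d \<le> t then 1 else 0) = (1::nat) \<and> (\<forall>a b c w. ?B a (Suc b) c w \<longrightarrow> ?B a b (Suc c) w \<longrightarrow> ?B a b c w) \<and>
       (\<exists>a b c w. socle_point (glue ?B) a b c w)"
  proof (cases "d \<le> t")
    case False
    \<comment> \<open>Without \<open>w\<close> the second factor needs \<open>x^t\<close>, which
      forces \<open>E = d\<close> and cost at least \<open>d - t\<close>, one too much. Raising
      \<open>x\<close> or \<open>w\<close> allows \<open>E = d - 1\<close>, raising \<open>y\<close>
      allows the free \<open>E = d + 1\<close>, and raising \<open>z\<close> pays the cost.\<close>
    let ?a = "(d + 2) * t - d + t"
    have dt: "d \<le> (d + 2) * t" using t by (cases t) auto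
    have "\<exists>a b c w. socle_point ?B a b c w"
    proof (rule socle_pointI[of _ ?a d "d - 1 - t" 0])
      show "\<not> ?B ?a d (d - 1 - t) 0"
      proof
        assume "?B ?a d (d - 1 - t) 0"
        then obtain E C X Z W where *: "rise_sum d t E C" "gens_sum const_gens t X Z W"
          "(d + 2) * t + X \<le> ?a + E" "E \<le> d" "C + Z \<le> d - 1 - t" "W \<le> 0"
          unfolding power_block_iff by auto
        have "X = t" using *(2,6) by (simp add: const_gens_sum)
        moreover have "E \<le> C + t" by (rule rise_sum_cost_ge[OF *(1,4)])
        ultimately show False using *(3-5) dt False by linarith
      qed
      show "?B (Suc ?a) d (d - 1 - t) 0"
        by (rule I[of "d - 1" "d - 1 - t" t 0 0]; use rise_sum_cost[of t "d - 1" d] t False dt in \<open>simp add: const_gens_sum\<close>)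
      show "?B ?a (Suc d) (d - 1 - t) 0"
        by (rule I[of "Suc d" 0 t 0 0]; use rise_sum_Suc_d[of t d] t dt in \<open>simp add: const_gens_sum\<close>)
      show "?B ?a d (Suc (d - 1 - t)) 0"
        by (rule I[of d "d - t" t 0 0]; use rise_sum_cost[of t d d] t False dt in \<open>simp add: const_gens_sum\<close>)
      show "?B ?a d (d - 1 - t) (Suc 0)"
        by (rule I[of "d - 1" "d - 1 - t" "t - 1" 0 1]; use rise_sum_cost[of t "d - 1" d] t False dt in \<open>simp add: const_gens_sum\<close>)
    qed
    then show ?thesis using False by simp
  next
    case True
    \<comment> \<open>For \<open>t \<ge> d\<close> the cost can be taken to be 0 and
      \<open>const_gens\<close> has no \<open>z\<close>, so the exponent of \<open>z\<close> is
      irrelevant.\<close>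
    have W: "?B a b c w" if "?B a b (Suc c) w" for a b c w
    proof -
      obtain E C X Z W where *: "rise_sum d t E C" "gens_sum const_gens t X Z W"
          "(d + 2) * t + X \<le> a + E" "E \<le> b" "W \<le> w"
        using \<open>?B a b (Suc c) w\<close> unfolding power_block_iff by auto
      show ?thesis
        by (rule I[of E 0 X Z W]) (use * rise_sum_all[OF True rise_sum_le[OF *(1)]] in \<open>simp_all add: const_gens_sum\<close>)
    qed
    let ?a = "(d + 2) * t + t - 1"
    have "\<exists>a b c w. socle_point (glue ?B) a b c w"
    proof (rule socle_pointI[of _ ?a 0 0 0])
      show "\<not> glue ?B ?a 0 0 0"
      proof
        assume "glue ?B ?a 0 0 0"
        then obtain E X Z W where *: "gens_sum const_gens t X Z W" "(d + 2) * t + X \<le> ?a + E" "E \<le> 0" "W \<le> 0"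
          unfolding glue_def power_block_iff by auto
        then show False using t by (simp add: const_gens_sum)
      qed
      have "?B (Suc ?a) 0 0 0"
        by (rule I[of 0 0 t 0 0]; use rise_sum_all[of d t 0] t True in \<open>simp add: const_gens_sum\<close>)
      then show "glue ?B (Suc ?a) 0 0 0" by (rule glueI) simp
      have "?B ?a 1 0 0"
        by (rule I[of 1 0 t 0 0]; use rise_sum_all[of d t 1] t True in \<open>simp add: const_gens_sum\<close>)
      then show "glue ?B ?a (Suc 0) 0 0" "glue ?B ?a 0 (Suc 0) 0" by (rule glueI, simp)+
      have "?B ?a 0 0 1"
        by (rule I[of 0 0 "t - 1" 0 1]; use rise_sum_all[of d t 0] t True in \<open>simp add: const_gens_sum\<close>)
      then show "glue ?B ?a 0 0 (Suc 0)" by (intro glueI[of ?B ?a 0 0]) simp_all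
    qed
    then show ?thesis using True W by simp
  qed
qed

text \<open>At the chosen point the cost bound leaves at most \<open>d\<close> for
  \<open>X + Z\<close>, so the second factor falls one short of its degree \<open>(d+1)t\<close>.
  The memberships use \<open>t - 1\<close> generators \<open>w^(d+1)\<close> and one that contains
  \<open>z\<close>.\<close>

lemma socle_before:
  assumes t: "1 \<le> t" "t < d"
  shows "\<exists>a b c w. socle_point (power_block (block d (drop_gens d)) t) a b c w"
proof -
  let ?B = "power_block (block d (drop_gens d)) t"
  obtain s where s: "t = Suc s" using t by (cases t) auto
  obtain q where q: "d = Suc q" using t by (cases d) auto
  note G = drop_gens_sum[of d t]
  note I = power_block_blockI[of d t _ _ "drop_gens d"]
  have g: "gens_sum (drop_gens d) t d 1 ((d + 1) * s)" "gens_sum (drop_gens d) t (d - 1) 1 ((d + 1) * s + 1)"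
    using t unfolding s q by (simp_all add: drop_gens_sum algebra_simps)
  show ?thesis
  proof (rule socle_pointI[of _ "(d + 2) * t" d "d - t" "(d + 1) * s"])
    show "\<not> ?B ((d + 2) * t) d (d - t) ((d + 1) * s)"
    proof
      assume "?B ((d + 2) * t) d (d - t) ((d + 1) * s)"
      then obtain E C X Z W where *: "rise_sum d t E C" "gens_sum (drop_gens d) t X Z W"
        "(d + 2) * t + X \<le> (d + 2) * t + E" "E \<le> d" "C + Z \<le> d - t" "W \<le> (d + 1) * s"
        unfolding power_block_iff by auto
      have "X + Z + W = (d + 1) * s + (d + 1)" using *(2) G t by (simp add: s)
      moreover have "E \<le> C + t" by (rule rise_sum_cost_ge[OF *(1,4)])
      ultimately show False using *(3-6) t by linarith
    qed
    show "?B (Suc ((d + 2) * t)) d (d - t) ((d + 1) * s)"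
      by (rule I[of "d - 1" "d - 1 - t", OF _ g(1)]) (use rise_sum_cost[of t "d - 1" d] t in simp_all)
    show "?B ((d + 2) * t) (Suc d) (d - t) ((d + 1) * s)"
      by (rule I[of "Suc d" 0, OF _ g(1)]) (use rise_sum_Suc_d[of t d] t in simp_all)
    show "?B ((d + 2) * t) d (Suc (d - t)) ((d + 1) * s)"
      by (rule I[of d "d - t", OF _ g(1)]) (use rise_sum_cost[of t d d] t in simp_all)
    show "?B ((d + 2) * t) d (d - t) (Suc ((d + 1) * s))"
      by (rule I[of "d - 1" "d - 1 - t", OF _ g(2)]) (use rise_sum_cost[of t "d - 1" d] t in simp_all)
  qed
qed

text \<open>The first factor costs no \<open>z\<close>, and the rest is one degree short of
  \<open>J^t\<close>. The added \<open>z\<close> is absorbed by \<open>d + 1\<close> copies of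
  \<open>w x^(d-1) z\<close>, which needs \<open>t > d\<close>; an added \<open>x\<close> or
  \<open>y\<close> by \<open>d\<close> copies of \<open>x^d z\<close>; an added \<open>w\<close> by
  one copy of the former and \<open>d - 1\<close> of the latter.\<close>

lemma socle_after:
  assumes d: "1 \<le> d" and t: "d < t"
  shows "\<exists>a b c w. socle_point (power_block (block d (drop_gens d)) t) a b c w"
proof -
  let ?B = "power_block (block d (drop_gens d)) t"
  obtain s where s: "t = Suc (d + s)" using less_imp_Suc_add[OF t] by blast
  obtain q where q: "d = Suc q" using d by (cases d) auto
  define m x v where "m = (d + 2) * t" and "x = (d + 1) * (d - 1)" and "v = (d + 1) * Suc s"
  note defs = x_def v_def
  have g: "gens_sum (drop_gens d) t (Suc x) d v" "gens_sum (drop_gens d) t x (Suc d) v"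
    "gens_sum (drop_gens d) t x d (Suc v)"
    unfolding s q defs by (simp_all add: drop_gens_sum algebra_simps)
  note I = power_block_blockI[of d t _ _ "drop_gens d", folded m_def]
  have r: "rise_sum d t 0 0" "rise_sum d t 1 0"
    using rise_sum_all[of d t] t by simp_all
  show ?thesis
  proof (rule socle_pointI[of _ "m + x" 0 d v])
    show "\<not> ?B (m + x) 0 d v"
    proof
      assume "?B (m + x) 0 d v"
      then obtain X Z W where *: "gens_sum (drop_gens d) t X Z W" "X \<le> x" "Z \<le> d" "W \<le> v"
        unfolding power_block_iff m_def by auto
      have "X + Z + W = (d + 1) * t" using *(1) d by (simp add: drop_gens_sum)
      also have "\<dots> = Suc (x + d + v)" by (simp add: s q defs algebra_simps)
      finally show False using *(2-4) by linarith
    qed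
    show "?B (Suc (m + x)) 0 d v"
      by (rule I[OF r(1) g(1)]) simp_all
    show "?B (m + x) (Suc 0) d v"
      by (rule I[OF r(2) g(1)]) simp_all
    show "?B (m + x) 0 (Suc d) v"
      by (rule I[OF r(1) g(2)]) simp_all
    show "?B (m + x) 0 d (Suc v)"
      by (rule I[OF r(1) g(3)]) simp_all
  qed
qed

lemma exchange_at:
  assumes d: "1 \<le> d"
    and y: "power_block (block d (drop_gens d)) d a (Suc b) c w"
    and z: "power_block (block d (drop_gens d)) d a b (Suc c) w"
  shows "power_block (block d (drop_gens d)) d a b c w"
proof -
  note I = power_block_blockI[of d d _ _ "drop_gens d"]
  from y obtain E C X Z W where *: "rise_sum d d E C" "gens_sum (drop_gens d) d X Z W"
    "(d + 2) * d + X \<le> a + E" "E \<le> Suc b" "C + Z \<le> c" "W \<le> w"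
    unfolding power_block_iff by auto
  from z obtain E' C' X' Z' W' where **: "rise_sum d d E' C'" "gens_sum (drop_gens d) d X' Z' W'"
    "(d + 2) * d + X' \<le> a + E'" "E' \<le> b" "C' + Z' \<le> Suc c" "W' \<le> w"
    unfolding power_block_iff by auto
  consider "E \<le> b" | "Z' \<le> c" | "E = Suc b" "Z' = Suc c"
    using *(4) **(5) by linarith
  then show ?thesis
  proof cases
    case 1
    then show ?thesis using * by (intro I[OF *(1,2)])
  next
    case 2
    then show ?thesis
      using ** by (intro I[OF rise_sum_all[OF order_refl rise_sum_le[OF **(1)]] **(2)]) simp_all
  next
    \<comment> \<open>Here both hypotheses are tight. The product of \<open>c\<close> generators
      \<open>x^d z\<close> and \<open>d - c\<close> generators \<open>w^(d+1)\<close> fits: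
      \<open>y\<close> bounds the exponent of \<open>w\<close>, and \<open>z\<close> that of
      \<open>x\<close> because \<open>d c \<le> (d-1)(c+1)\<close> for \<open>c < d\<close>.\<close>
    case 3
    obtain q where q: "d = Suc q" using d by (cases d) auto
    have c: "c < d" and X': "(d - 1) * Suc c \<le> X'"
      using **(2) d 3(2) by (simp_all add: drop_gens_sum del: mult_Suc_right)
    obtain r where r: "d = Suc (c + r)" using less_imp_Suc_add[OF c] by blast
    have dc: "d * c \<le> (d - 1) * Suc c" by (simp add: r algebra_simps)
    have "(d + 1) * d \<le> W + (d + 1) * Z" using *(2) d by (simp add: drop_gens_sum)
    moreover have "(d + 1) * Z \<le> (d + 1) * c" using *(5) by (intro mult_le_mono2) simp
    moreover have "(d + 1) * d = (d + 1) * (d - c) + (d + 1) * c"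
      using c by (simp flip: distrib_left)
    ultimately have W: "(d + 1) * (d - c) \<le> w" using *(6) by linarith
    have "gens_sum (drop_gens d) d (d * c) c ((d + 1) * (d - c))"
      unfolding drop_gens_sum[OF d] by (simp add: r algebra_simps)
    moreover have "rise_sum d d b 0"
      using rise_sum_le[OF *(1)] 3(1) by (intro rise_sum_all) simp_all
    ultimately show ?thesis
      using **(3,4) dc X' W by (intro I[of b 0 "d * c" c "(d + 1) * (d - c)"]) simp_all
  qed
qed

text \<open>After gluing, the degree decides: the point lies one below the least degree
  \<open>(2d+3)d\<close> of the power, and one generator containing \<open>z\<close> together with
  \<open>d - 1\<close> generators \<open>w^(d+1)\<close> serves for all memberships.\<close>

lemma socle_at:
  assumes d: "1 \<le> d"
  shows "\<exists>a b c w. socle_point (glue (power_block (block d (drop_gens d)) d)) a b c w"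
proof -
  let ?B = "power_block (block d (drop_gens d)) d"
  obtain q where q: "d = Suc q" using d by (cases d) auto
  define b v where "b = (d + 2) * d" and "v = (d + 1) * (d - 1)"
  have g: "gens_sum (drop_gens d) d d 1 v" "gens_sum (drop_gens d) d (d - 1) 1 (Suc v)"
    unfolding q v_def by (simp_all add: drop_gens_sum algebra_simps)
  note I = power_block_blockI[of d d _ _ "drop_gens d", folded b_def]
  have r: "rise_sum d d E 0" if "E \<le> b" for E using rise_sum_all[of d d E] that by (simp add: b_def)
  have b: "1 \<le> b" using d by (simp add: b_def)
  show ?thesis
  proof (rule socle_pointI[of _ d b 0 v])
    show "\<not> glue ?B d b 0 v"
    proof
      assume "glue ?B d b 0 v"
      then obtain i j E C X Z W where *: "i + j = b" "gens_sum (drop_gens d) d X Z W" "b + X \<le> d + E" "E \<le> i" "C + Z \<le> j" "W \<le> v"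
        unfolding glue_def power_block_iff b_def by auto
      have "X + Z + W = (d + 1) * d" using *(2) d by (simp add: drop_gens_sum)
      also have "\<dots> = Suc (d + v)" by (simp add: q v_def algebra_simps)
      finally show False using * by linarith
    qed
    have "?B (Suc d) (b - 1) 1 v" by (rule I[OF r[of "b - 1"] g(1)]) (use b in simp_all)
    then show "glue ?B (Suc d) b 0 v" by (rule glueI) (use b in simp)
    have "?B d b 1 v" by (rule I[OF r[of b] g(1)]) simp_all
    then show "glue ?B d (Suc b) 0 v" "glue ?B d b (Suc 0) v" by (rule glueI, simp)+
    have "?B d (b - 1) 1 (Suc v)" by (rule I[OF r[of "b - 1"] g(2)]) (use b d in simp_all)
    then show "glue ?B d b 0 (Suc v)" by (rule glueI) (use b in simp)
  qed
qed

lemma good_block_drop: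
  assumes d: "1 \<le> d"
  shows "good_block (block d (drop_gens d)) (\<lambda>t. if t = d then 1 else 0)"
  unfolding good_block_def
proof (intro allI impI)
  fix t :: nat assume t: "1 \<le> t"
  let ?B = "power_block (block d (drop_gens d))"
  consider "t < d" | "t = d" | "d < t" by linarith
  then show "(if t = d then 1 else 0) = (0::nat) \<and> (\<exists>a b c w. socle_point (?B t) a b c w) \<or>
     (if t = d then 1 else 0) = (1::nat) \<and> (\<forall>a b c w. ?B t a (Suc b) c w \<longrightarrow> ?B t a b (Suc c) w \<longrightarrow> ?B t a b c w) \<and>
       (\<exists>a b c w. socle_point (glue (?B t)) a b c w)"
  proof cases
    case 1
    then show ?thesis using socle_before[OF t] by simp
  next
    case 2
    then show ?thesis using socle_at[OF d] exchange_at[OF d] by simp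
  next
    case 3
    then show ?thesis using socle_after[OF d] by simp
  qed
qed

section \<open>Assembly of the prescribed depth function\<close>

lemma sum_list_concat_replicate:
  "sum_list (map g (concat (map (\<lambda>d. replicate (f d) (p d)) ds))) = (\<Sum>d\<leftarrow>ds. f d * (g (p d) :: nat))"
  by (induction ds) (simp_all add: sum_list_replicate)

theorem theorem4p1:
  fixes f :: "nat \<Rightarrow> nat"
  assumes conv: "\<exists>t0\<ge>1. \<forall>t\<ge>t0. f t = f t0"
  shows "\<exists>(n::nat) (Q :: ('k::field) mpoly set).
           monomial_ideal n Q \<and>
           (\<forall>t\<ge>1. depth_quot n (ideal_pow n Q t) = enat (f t))"
proof -
  obtain t0 where t0: "1 \<le> t0" "\<And>t. t0 \<le> t \<Longrightarrow> f t = f t0" using conv by blast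
  \<comment> \<open>\<open>f d\<close> blocks supply the value at each single \<open>d < t0\<close>,
    and \<open>f t0\<close> blocks supply the constant value from \<open>t0\<close> on.\<close>
  define L where "L = concat (map (\<lambda>d. replicate (f d) (block d (drop_gens d), \<lambda>t. if t = d then 1 else 0 :: nat)) [1..<t0])
    @ replicate (f t0) (block t0 const_gens, \<lambda>t. if t0 \<le> t then 1 else 0)"
  define N where "N = length L"
  define G w where "G k = fst (L ! k)" and "w k = snd (L ! k)" for k
  have good: "good_block (G k) (w k)" if "k < N" for k
  proof -
    have "L ! k \<in> set L" using that by (simp add: N_def)
    then show ?thesis
      using good_block_drop good_block_const t0(1) by (auto simp: L_def G_def w_def)
  qed
  have sum: "(\<Sum>k<N. w k t) = f t" if t: "1 \<le> t" for t
  proof -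
    have "(\<Sum>k<N. w k t) = sum_list (map (\<lambda>p. snd p t) L)"
      by (simp add: sum_list_sum_nth N_def w_def atLeast0LessThan)
    also have "\<dots> = (\<Sum>d\<leftarrow>[1..<t0]. f d * (if t = d then 1 else 0)) + f t0 * (if t0 \<le> t then 1 else 0)"
      by (simp add: L_def sum_list_concat_replicate sum_list_replicate)
    also have "(\<Sum>d\<leftarrow>[1..<t0]. f d * (if t = d then 1 else 0)) = (if t < t0 then f t else 0)"
    proof -
      have "(\<Sum>d\<leftarrow>[1..<t0]. f d * (if t = d then 1 else 0)) = (\<Sum>d\<in>{1..<t0}. if t = d then f d else 0)"
        unfolding interv_sum_list_conv_sum_set_nat by (rule sum.cong) auto
      then show ?thesis using t by simp
    qed
    finally show ?thesis using t0(2)[of t] by simp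
  qed
  interpret block_product N G .
  let ?Q = "mon_span (3 * N + 1) (U (Suc 0)) :: 'k mpoly set"
  have "monomial_ideal (3 * N + 1) ?Q" by (rule monomial_ideal_mon_span) (rule U_up)
  moreover have "depth_quot (3 * N + 1) (ideal_pow (3 * N + 1) ?Q t) = enat (f t)" if "1 \<le> t" for t
    using depth_product[of t w] good sum that by simp
  ultimately show ?thesis by blast
qed

end
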